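(* Let $T\subset\mathbb{R}^3$ be a regular tetrahedron with edge length $1$ and let $B\subset\mathbb{R}^3$ be a ball of radius $\frac{\sqrt6-\sqrt2}{4}$. Consider the Minkowski interpolations of $T$ and $B$, in which the ball is scaled by a factor $\lambda\in[0,1]$ and the tetrahedron by the complementary factor $1-\lambda$, that is, the bodies $(1-\lambda)T+\lambda B$, and the volume ratio $\operatorname{Vol}\big((1-\lambda)T+\lambda B\big)/\operatorname{Vol}(T)$. Put $\alpha=\cos^{-1}\left(\frac13\right)$ and $$c_1=6\sqrt3+3\sqrt6-5\sqrt2-12,$$ $$c_2=9\sqrt3+3\sqrt6-5\sqrt2-18,$$ $$c_3=24-12\sqrt3+18\sqrt6,$$ $$c_4=38-33\sqrt2-22\sqrt3,$$ $$c_5=63-36\sqrt3,$$ $$c_6=33\sqrt2-18\sqrt6,$$ $$c_7=72\sqrt3-126,$$ $$c_8=63-36\sqrt3,$$ $$c_9=9\sqrt3+3\sqrt6-18-5\sqrt2.$$ Then the maximum volume ratio for the Minkowski interpolation of the tetrahedron and the ball is obtained by scaling the ball by $$\lambda=\frac{3\sqrt2-\sqrt6+c_1\pi+(12-6\sqrt3)\alpha}{8\sqrt2-3\sqrt6+c_2\pi+(18-9\sqrt3)\alpha}+\sqrt{\frac{c_3+c_4\pi+c_5\pi^2+c_6\alpha+c_7\pi\alpha+c_8\alpha^2}{8\sqrt2-3\sqrt6+c_9\pi+18\alpha-9\sqrt3\,\alpha^2}}\approx 0.68424688,$$ and the corresponding volume ratio is approximately $1.124358246$.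
   Context: For sets $X,Y\subset\mathbb{R}^3$ and scaling constants $a,b$, the Minkowski interpolation is the Minkowski sum $aX+bY=\{ax+by: x\in X,\ y\in Y\}$. $\operatorname{Vol}$ denotes three-dimensional volume.
   Formalization: As printed the claim fails. Corrected: λ scales the tetrahedron and 1−λ the ball; the term 18√6 belongs to c4, not c3; the denominator under the root is (8√2−3√6+c9π+(18−9√3)α)². "Approximately" means within 10⁻⁷ for λ and 10⁻⁸ for the ratio. *)

theory Defs
  imports "HOL-Analysis.Analysis"
begin

definition regular_tetrahedron :: "real \<Rightarrow> (real ^ 3) set \<Rightarrow> bool" where
  "regular_tetrahedron e T \<longleftrightarrow>
     e > 0 \<and>
     (\<exists>p q r s. dist p q = e \<and> dist p r = e \<and> dist p s = e \<and>
                dist q r = e \<and> dist q s = e \<and> dist r s = e \<and>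
                T = convex hull {p, q, r, s})"

definition minkowski_interp ::
  "real \<Rightarrow> (real ^ 3) set \<Rightarrow> real \<Rightarrow> (real ^ 3) set \<Rightarrow> (real ^ 3) set" where
  "minkowski_interp a X b Y = {a *\<^sub>R x + b *\<^sub>R y | x y. x \<in> X \<and> y \<in> Y}"

definition Vol :: "(real ^ 3) set \<Rightarrow> real" where
  "Vol X = measure lebesgue X"

definition volume_ratio :: "(real ^ 3) set \<Rightarrow> (real ^ 3) set \<Rightarrow> real \<Rightarrow> real" where
  "volume_ratio T B t = Vol (minkowski_interp (1 - t) T t B) / Vol T"

definition alpha :: real where
  "alpha = arccos (1 / 3)"

text \<open>
  With ball radius \<open>r = (sqrt 6 - sqrt 2) / 4\<close> and the tetrahedron scaled by
  \<open>u\<close>, Steiner's formula makes the volume of the interpolation the cubic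
  \<open>sqrt 2 / 12 * u^3 + sqrt 3 * r * u^2 * (1 - u)
   + 3 * (pi - alpha) * r^2 * u * (1 - u)^2 + 4 / 3 * pi * r^3 * (1 - u)^3\<close>.
  The number \<open>lambda_opt\<close> below is the root in \<open>[0, 1]\<close> of its derivative.
  Thus it is the factor of the tetrahedron, and the ball is scaled by
  \<open>1 - lambda_opt\<close>; the published statement has these two roles exchanged,
  but scaling the ball by 0.68424688 gives a volume ratio of only about 0.97.

  The published closed form, read literally, has value about 2.96 and not the
  0.68424688 given with it.  It is corrected here in two places: the term
  \<open>18 * sqrt 6\<close> is in \<open>c4\<close> instead of \<open>c3\<close>, and the denominator
  under the root is the square of
  \<open>8 * sqrt 2 - 3 * sqrt 6 + c9 * pi + (18 - 9 * sqrt 3) * alpha\<close>.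
\<close>

definition c1 :: real where "c1 = 6 * sqrt 3 + 3 * sqrt 6 - 5 * sqrt 2 - 12"
definition c2 :: real where "c2 = 9 * sqrt 3 + 3 * sqrt 6 - 5 * sqrt 2 - 18"
definition c3 :: real where "c3 = 24 - 12 * sqrt 3"
definition c4 :: real where "c4 = 38 - 33 * sqrt 2 - 22 * sqrt 3 + 18 * sqrt 6"
definition c5 :: real where "c5 = 63 - 36 * sqrt 3"
definition c6 :: real where "c6 = 33 * sqrt 2 - 18 * sqrt 6"
definition c7 :: real where "c7 = 72 * sqrt 3 - 126"
definition c8 :: real where "c8 = 63 - 36 * sqrt 3"
definition c9 :: real where "c9 = 9 * sqrt 3 + 3 * sqrt 6 - 18 - 5 * sqrt 2"

definition lambda_opt :: real where
  "lambda_opt =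
     (3 * sqrt 2 - sqrt 6 + c1 * pi + (12 - 6 * sqrt 3) * alpha) /
     (8 * sqrt 2 - 3 * sqrt 6 + c2 * pi + (18 - 9 * sqrt 3) * alpha) +
     sqrt ((c3 + c4 * pi + c5 * pi\<^sup>2 + c6 * alpha + c7 * pi * alpha + c8 * alpha\<^sup>2) /
           (8 * sqrt 2 - 3 * sqrt 6 + c9 * pi + (18 - 9 * sqrt 3) * alpha)\<^sup>2)"

end

theory Submission
  imports Defs
begin

text \<open>
  Up to a translation, the tetrahedron scaled by \<open>u\<close> is the convex hull of the points \<open>\<sigma> w\<^sub>i\<close> with
  \<open>\<sigma> = u / (2 sqrt 2)\<close>, where the four vectors \<open>w\<^sub>i\<close> sum to 0 and \<open>- w\<^sub>i\<close> is normal to the face opposite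
  to \<open>\<sigma> w\<^sub>i\<close>. Every point is \<open>\<Sum> m\<^sub>i w\<^sub>i\<close> for exactly one \<open>m\<close> whose positive parts sum to \<open>\<sigma>\<close>: the
  positive parts of \<open>m\<close> give its nearest point in the tetrahedron, the negative parts the displacement.
  Sorting the points of the parallel body by the set of indices with \<open>m\<^sub>i > 0\<close> cuts it into a simplex,
  four prisms, six wedges of opening angle \<open>pi - alpha\<close>, and four ball sectors that tile the ball; all
  but the last are linear images of regions measured by Fubini. The resulting cubic has \<open>lambda_opt\<close> as
  critical point, and its value at \<open>s\<close> differs from that at \<open>lambda_opt\<close> by \<open>(s - lambda_opt)\<^sup>2\<close>
  times a linear function of \<open>s\<close> that is negative on \<open>[0, 1]\<close>.
\<close>

section \<open>Lebesgue measure on \<open>real ^ 3\<close> in nested product coordinates\<close>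

lemma prod_diff_Basis:
  "(\<Prod>i\<in>UNIV. u $ i - l $ i) = (\<Prod>b\<in>Basis. (u - l) \<bullet> b)" for u l :: "real ^ 'n"
  unfolding Basis_vec_def
  by (simp add: UNION_singleton_eq_range prod.reindex inj_on_def axis_eq_axis inner_axis)

text \<open>Regions are measured in nested pairs, where Fubini applies, and carried to
  \<open>real ^ 3\<close> by this bijection.\<close>

definition vec3 :: "real \<times> real \<times> real \<Rightarrow> real ^ 3" where
  "vec3 = (\<lambda>(x, y, z). vector [x, y, z])"

lemma vec3_nth [simp]: "vec3 p $ 1 = fst p" "vec3 p $ 2 = fst (snd p)" "vec3 p $ 3 = snd (snd p)"
  by (auto simp: vec3_def split: prod.splits)

lemma emeasure_lborel_Times:
  assumes "X \<in> sets borel" "Y \<in> sets borel"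
  shows "emeasure lborel (X \<times> Y) = emeasure lborel X * emeasure lborel Y"
  unfolding lborel_prod[symmetric] using assms by (intro lborel.emeasure_pair_measure_Times) auto

lemma vec3_measurable [measurable]: "vec3 \<in> borel_measurable borel"
proof -
  have eq: "vec3 = (\<lambda>p. fst p *\<^sub>R axis 1 1 + fst (snd p) *\<^sub>R axis 2 1 + snd (snd p) *\<^sub>R axis 3 1)"
    by (auto simp: vec_eq_iff forall_3 axis_def)
  show ?thesis unfolding eq by (intro borel_measurable_continuous_onI continuous_intros)
qed

text \<open>Lebesgue-Borel measure is determined by its values on boxes, and the preimage of a box
  under \<open>vec3\<close> is a product of three intervals.\<close>

lemma lborel_vec3: "lborel = distr lborel borel vec3"
proof (rule lborel_eqI)
  fix l u :: "real ^ 3"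
  assume le: "\<And>b. b \<in> Basis \<Longrightarrow> l \<bullet> b \<le> u \<bullet> b"
  then have le: "l $ i \<le> u $ i" for i
    using le[of "axis i 1"] by (simp add: inner_axis)
  have "vec3 -` box l u = {l$1 <..< u$1} \<times> {l$2 <..< u$2} \<times> {l$3 <..< u$3}"
    by (auto simp: mem_box_cart forall_3)
  then have "emeasure (distr lborel borel vec3) (box l u)
      = emeasure lborel ({l$1 <..< u$1} \<times> {l$2 <..< u$2} \<times> {l$3 <..< u$3})"
    by (simp add: emeasure_distr)
  also have "\<dots> = ennreal (u$1 - l$1) * (ennreal (u$2 - l$2) * ennreal (u$3 - l$3))"
    using le emeasure_lborel_Times[of "{l$1 <..< u$1}" "{l$2 <..< u$2} \<times> {l$3 <..< u$3}"]
      emeasure_lborel_Times[of "{l$2 <..< u$2}" "{l$3 <..< u$3}"] borel_Times[of "{l$2 <..< u$2}" "{l$3 <..< u$3}"]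
    by simp
  also have "\<dots> = ennreal ((u$1 - l$1) * ((u$2 - l$2) * (u$3 - l$3)))"
    using le[of 1] le[of 2] le[of 3] by (simp only: ennreal_mult mult_nonneg_nonneg diff_ge_0_iff_ge)
  also have "(u$1 - l$1) * ((u$2 - l$2) * (u$3 - l$3)) = (\<Prod>i\<in>UNIV. u$i - l$i)"
    unfolding UNIV_3 by simp
  also note prod_diff_Basis
  finally show "emeasure (distr lborel borel vec3) (box l u) = (\<Prod>b\<in>Basis. (u - l) \<bullet> b)" .
qed simp

lemma measure_vec3_image:
  assumes [measurable]: "Q \<in> sets borel" and "emeasure lborel Q = ennreal c" "0 \<le> c"
  shows "vec3 ` Q \<in> lmeasurable" "measure lebesgue (vec3 ` Q) = c"
proof -
  \<comment> \<open>Writing the image as a preimage under the continuous coordinate map shows that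
    it is Borel.\<close>
  have eq: "vec3 ` Q = (\<lambda>x. (x$1, x$2, x$3)) -` Q"
  proof (intro set_eqI iffI)
    fix x :: "real^3" assume "x \<in> (\<lambda>x. (x$1, x$2, x$3)) -` Q"
    moreover have "x = vec3 (x$1, x$2, x$3)" by (simp add: vec_eq_iff forall_3)
    ultimately show "x \<in> vec3 ` Q" by blast
  qed auto
  have "(\<lambda>x::real^3. (x$1, x$2, x$3)) \<in> borel_measurable borel"
    by (intro borel_measurable_continuous_onI continuous_intros)
  then have im: "vec3 ` Q \<in> sets borel"
    unfolding eq using assms(1) by (rule measurable_sets_borel)
  have inj: "vec3 -` vec3 ` Q = Q"
    by (intro inj_vimage_image_eq injI) (auto simp: vec_eq_iff forall_3 prod_eq_iff)
  have e: "emeasure lborel (vec3 ` Q) = ennreal c"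
    using assms im by (subst lborel_vec3) (simp add: emeasure_distr inj)
  then show "measure lebesgue (vec3 ` Q) = c"
    using im assms by (subst measure_completion) (simp_all add: measure_def)
  show "vec3 ` Q \<in> lmeasurable"
    using e im by (intro fmeasurableI) auto
qed

section \<open>Volumes of the model regions by slicing\<close>

text \<open>Fubini followed by the fundamental theorem of calculus, with slice measure
  \<open>f\<close> and antiderivative \<open>F\<close>. Slices are prescribed only on the open
  interval because the two endpoints form a null set, so regions with open and with closed ends are
  treated alike.\<close>

lemma emeasure_lborel_slices:
  fixes Q :: "(real \<times> 'b::euclidean_space) set"
  assumes Q: "Q \<in> sets borel" and "a \<le> b"
    and slice: "\<And>x. x \<in> {a<..<b} \<Longrightarrow> emeasure lborel (Pair x -` Q) = ennreal (f x)"
    and empty: "\<And>x. x \<notin> {a..b} \<Longrightarrow> Pair x -` Q = {}"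
    and nonneg: "\<And>x. x \<in> {a..b} \<Longrightarrow> 0 \<le> f x"
    and deriv: "\<And>x. x \<in> {a..b} \<Longrightarrow> (F has_real_derivative f x) (at x)"
  shows "emeasure lborel Q = ennreal (F b - F a)"
proof -
  have "emeasure lborel Q = (\<integral>\<^sup>+x. emeasure lborel (Pair x -` Q) \<partial>lborel)"
    unfolding lborel_prod[symmetric]
    using Q unfolding borel_prod[symmetric] by (intro lborel.emeasure_pair_measure_alt) simp
  also have "\<dots> = (\<integral>\<^sup>+x. ennreal (f x) * indicator {a..b} x \<partial>lborel)"
  proof (rule nn_integral_cong_AE)
    show "AE x in lborel. emeasure lborel (Pair x -` Q) = ennreal (f x) * indicator {a..b} x"
      using AE_lborel_singleton[of a] AE_lborel_singleton[of b]
    proof eventually_elim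
      case (elim x)
      then show ?case
        using slice[of x] empty[of x] by (auto split: split_indicator)
    qed
  qed
  also have "\<dots> = ennreal (F b - F a)"
  proof (intro nn_integral_has_integral_lebesgue' nonneg)
    show "(f has_integral F b - F a) {a..b}"
      using \<open>a \<le> b\<close> deriv
      by (intro fundamental_theorem_of_calculus)
         (auto simp: has_real_derivative_iff_has_vector_derivative intro: has_vector_derivative_at_within)
  qed
  finally show ?thesis .
qed

lemma emeasure_triangle:
  assumes "0 \<le> s"
  shows triangle_borel: "{(x, y). 0 < x \<and> 0 < y \<and> x + y < s} \<in> sets borel"
    and "emeasure lborel {(x, y). 0 < x \<and> 0 < y \<and> x + y < (s::real)} = ennreal (s^2 / 2)"
proof -
  let ?Q = "{(x, y). 0 < x \<and> 0 < y \<and> x + y < s}"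
  show *: "?Q \<in> sets borel"
    unfolding case_prod_unfold Collect_conj_eq
    by (intro sets.Int borel_open[OF open_Collect_less] borel_closed[OF closed_Collect_le] continuous_intros)
  have "emeasure lborel ?Q = ennreal ((s * s - s^2 / 2) - (s * 0 - 0^2 / 2))"
  proof (rule emeasure_lborel_slices[where f = "\<lambda>x. s - x" and F = "\<lambda>x. s * x - x^2 / 2"])
    fix x assume "x \<in> {0<..<s}"
    moreover from this have "Pair x -` ?Q = {0<..<s - x}" by auto
    ultimately show "emeasure lborel (Pair x -` ?Q) = ennreal (s - x)"
      by simp
  qed (use assms * in \<open>auto intro!: derivative_eq_intros\<close>)
  then show "emeasure lborel ?Q = ennreal (s^2 / 2)"
    by (simp add: power2_eq_square)
qed

lemma emeasure_simplex:
  assumes "0 \<le> s"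
  shows simplex_borel: "{(x, y, z). 0 < x \<and> 0 < y \<and> 0 < z \<and> x + y + z < s} \<in> sets borel"
    and "emeasure lborel {(x, y, z). 0 < x \<and> 0 < y \<and> 0 < z \<and> x + y + z < (s::real)} = ennreal (s^3 / 6)"
proof -
  let ?Q = "{(x, y, z). 0 < x \<and> 0 < y \<and> 0 < z \<and> x + y + z < s}"
  show *: "?Q \<in> sets borel"
    unfolding case_prod_unfold Collect_conj_eq
    by (intro sets.Int borel_open[OF open_Collect_less] borel_closed[OF closed_Collect_le] continuous_intros)
  have "emeasure lborel ?Q
    = ennreal (- ((s - s)^3 / 6) - - ((s - 0)^3 / 6))"
  proof (rule emeasure_lborel_slices[where f = "\<lambda>x. (s - x)^2 / 2" and F = "\<lambda>x. - ((s - x)^3 / 6)"])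
    fix x assume x: "x \<in> {0<..<s}"
    then have "Pair x -` ?Q
      = {(y, z). 0 < y \<and> 0 < z \<and> y + z < s - x}" by auto
    then show "emeasure lborel (Pair x -` ?Q)
      = ennreal ((s - x)^2 / 2)"
      using x by (simp add: emeasure_triangle)
  qed (use assms * in \<open>auto intro!: derivative_eq_intros simp: power2_eq_square\<close>)
  then show "emeasure lborel ?Q = ennreal (s^3 / 6)"
    by simp
qed

lemma emeasure_prism:
  assumes "0 \<le> s" "0 \<le> h"
  shows prism_borel: "{(z, x, y). 0 \<le> z \<and> z \<le> h \<and> 0 < x \<and> 0 < y \<and> x + y < s} \<in> sets borel"
    and "emeasure lborel {(z, x, y). 0 \<le> z \<and> z \<le> h \<and> 0 < x \<and> 0 < y \<and> x + y < (s::real)} = ennreal (s^2 / 2 * h)"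
proof -
  let ?Q = "{(z, x, y). 0 \<le> z \<and> z \<le> h \<and> 0 < x \<and> 0 < y \<and> x + y < s}"
  show *: "?Q \<in> sets borel"
    unfolding case_prod_unfold Collect_conj_eq
    by (intro sets.Int borel_open[OF open_Collect_less] borel_closed[OF closed_Collect_le] continuous_intros)
  have "emeasure lborel ?Q
    = ennreal (s^2 / 2 * h - s^2 / 2 * 0)"
  proof (rule emeasure_lborel_slices[where f = "\<lambda>_. s^2 / 2" and F = "\<lambda>x. s^2 / 2 * x"])
    fix x assume x: "x \<in> {0<..<h}"
    then have "Pair x -` ?Q
      = {(y, z). 0 < y \<and> 0 < z \<and> y + z < s}" by auto
    then show "emeasure lborel (Pair x -` ?Q)
      = ennreal (s^2 / 2)"
      using assms by (simp add: emeasure_triangle)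
  qed (use assms * in \<open>auto intro!: derivative_eq_intros simp: power2_eq_square\<close>)
  then show "emeasure lborel ?Q = ennreal (s^2 / 2 * h)"
    by simp
qed

text \<open>Gives \<open>\<bar>x\<bar>\<close> an antiderivative across 0, so that the sector below
  needs no splitting into two halves.\<close>

lemma DERIV_mult_abs: "((\<lambda>x. x * \<bar>x\<bar>) has_real_derivative 2 * \<bar>x\<bar>) (at x)"
proof -
  consider "x < 0" | "x = 0" | "0 < x" by linarith
  then show ?thesis
  proof cases
    case 1
    then have "((\<lambda>x. x * - x) has_real_derivative 2 * \<bar>x\<bar>) (at x)"
      by (auto intro!: derivative_eq_intros)
    then show ?thesis
      by (rule has_field_derivative_transform_within_open[where S = "{..<0}"]) (use 1 in auto)
  next
    case 2
    have "(\<lambda>h::real. ((0 + h) * \<bar>0 + h\<bar> - 0 * \<bar>0\<bar>) / h) = (\<lambda>h. \<bar>h\<bar>)"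
      by (auto simp: fun_eq_iff)
    moreover have "((\<lambda>h. \<bar>h\<bar>) \<longlongrightarrow> \<bar>0::real\<bar>) (at 0)" by (intro tendsto_intros)
    ultimately show ?thesis unfolding 2 DERIV_def by simp
  next
    case 3
    then have "((\<lambda>x. x * x) has_real_derivative 2 * \<bar>x\<bar>) (at x)"
      by (auto intro!: derivative_eq_intros)
    then show ?thesis
      by (rule has_field_derivative_transform_within_open[where S = "{0<..}"]) (use 3 in auto)
  qed
qed

text \<open>Stretching \<open>d\<close> by \<open>sqrt 2\<close> turns the region into a circular
  sector of radius \<open>r\<close> whose half-angle has tangent \<open>sqrt 2\<close>, hence sine
  \<open>sqrt (2 / 3)\<close>. Its area is \<open>r^2\<close> times the half-angle, and undoing the
  stretch divides by \<open>sqrt 2\<close>.\<close>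

lemma emeasure_sector_pos:
  assumes "0 < r"
  shows "emeasure lborel {(d, s). \<bar>d\<bar> \<le> s \<and> s^2 + 2 * d^2 \<le> (r::real)^2}
      = ennreal (r^2 * arcsin (sqrt (2 / 3)) / sqrt 2)"
proof -
  let ?Q = "{(d, s). \<bar>d\<bar> \<le> s \<and> s^2 + 2 * d^2 \<le> r^2}"
  \<comment> \<open>The ellipse \<open>s^2 + 2 * d^2 = r^2\<close> meets the lines
    \<open>s = \<bar>d\<bar>\<close> at \<open>d = h\<close> and \<open>d = - h\<close>.\<close>
  define h where "h = r / sqrt 3"
  have h: "0 < h" "3 * h^2 = r^2" "(sqrt 2 * h / r)^2 = 2 / 3" "sqrt 2 * h / r = sqrt (2 / 3)"
    using assms by (auto simp: h_def power_divide real_sqrt_divide power_mult_distrib)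
  have *: "?Q \<in> sets borel"
    unfolding case_prod_unfold Collect_conj_eq
    by (intro sets.Int borel_closed[OF closed_Collect_le] continuous_intros)
  define f where "f d = sqrt (r^2 - 2 * d^2) - \<bar>d\<bar>" for d
  define F where "F d = (d * sqrt (r^2 - 2 * d^2) + r^2 / sqrt 2 * arcsin (sqrt 2 * d / r)) / 2 - d * \<bar>d\<bar> / 2" for d
  have le: "3 * x^2 \<le> r^2 \<longleftrightarrow> \<bar>x\<bar> \<le> h" for x
  proof -
    have "3 * x^2 \<le> r^2 \<longleftrightarrow> x^2 \<le> h^2" using h by linarith
    then show ?thesis using h by (simp add: abs_le_square_iff[symmetric])
  qed
  have "emeasure lborel ?Q = ennreal (F h - F (-h))"
  proof (rule emeasure_lborel_slices[where f = f and F = F])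
    fix x assume "x \<in> {-h<..<h}"
    then have x: "\<bar>x\<bar> \<le> h" by auto
    have *: "s^2 + 2 * x^2 \<le> r^2 \<longleftrightarrow> s \<le> sqrt (r^2 - 2 * x^2)" if "0 \<le> s" for s
    proof -
      have "s^2 + 2 * x^2 \<le> r^2 \<longleftrightarrow> sqrt (s^2) \<le> sqrt (r^2 - 2 * x^2)"
        by (simp only: real_sqrt_le_iff) linarith
      then show ?thesis using that by simp
    qed
    then have "Pair x -` ?Q = {\<bar>x\<bar>..sqrt (r^2 - 2 * x^2)}"
      by (auto simp: *)
    moreover have "\<bar>x\<bar> \<le> sqrt (r^2 - 2 * x^2)"
      using x le[of x] by (intro real_le_rsqrt) simp
    ultimately show "emeasure lborel (Pair x -` ?Q) = ennreal (f x)"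
      by (simp add: f_def)
  next
    fix x assume "x \<notin> {-h..h}"
    then have "\<not> \<bar>x\<bar> \<le> h" by auto
    then have "r^2 < 3 * x^2" using le[of x] by simp
    have "x^2 \<le> s^2" if "\<bar>x\<bar> \<le> s" for s
      using that by (intro abs_le_square_iff[THEN iffD1]) linarith
    then have "\<not> s^2 + 2 * x^2 \<le> r^2" if "\<bar>x\<bar> \<le> s" for s
      using that \<open>r^2 < 3 * x^2\<close> by force
    then show "Pair x -` ?Q = {}" by auto
  next
    fix x assume "x \<in> {-h..h}"
    then have x: "\<bar>x\<bar> \<le> h" by auto
    have x2: "3 * x^2 \<le> r^2" using x le by simp
    then show "0 \<le> f x"
      by (simp add: f_def) (intro real_le_rsqrt, simp)
    \<comment> \<open>Strictness holds even at the ends of the interval, which keeps the square root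
      and the arcsine differentiable on all of it.\<close>
    have pos: "0 < r^2 - 2 * x^2"
    proof (cases "x = 0")
      case False
      then have "0 < x^2" by simp
      then show ?thesis using x2 by linarith
    qed (use assms in simp)
    have "(sqrt 2 * x / r)^2 < 1"
      using pos assms by (simp add: power_divide power_mult_distrib)
    then have b: "-1 < sqrt 2 * x / r" "sqrt 2 * x / r < 1"
      unfolding abs_square_less_1 by linarith+
    have q: "sqrt (1 - (sqrt 2 * x / r)^2) = sqrt (r^2 - 2 * x^2) / r"
    proof -
      have "1 - (sqrt 2 * x / r)^2 = (r^2 - 2 * x^2) / r^2"
        using assms by (simp add: power_divide power_mult_distrib field_simps)
      then show ?thesis using assms by (simp add: real_sqrt_divide)
    qed
    define w where "w = sqrt (r^2 - 2 * x^2)"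
    have w: "0 < w" "w^2 = r^2 - 2 * x^2" using pos by (auto simp: w_def)
    note DERIV_mult_abs[of x]
    moreover have "((\<lambda>d. d * sqrt (r^2 - 2 * d^2)) has_real_derivative w - 2 * x^2 / w) (at x)"
      using pos w(1) unfolding w_def
      by (auto intro!: derivative_eq_intros simp: power2_eq_square field_simps)
    moreover have "((\<lambda>d. r^2 / sqrt 2 * arcsin (sqrt 2 * d / r)) has_real_derivative r^2 / w) (at x)"
    proof -
      have "((\<lambda>d. arcsin (sqrt 2 * d / r)) has_real_derivative inverse (sqrt (1 - (sqrt 2 * x / r)^2)) * (sqrt 2 / r)) (at x)"
        using b assms by (intro DERIV_chain2[OF DERIV_arcsin]) (auto intro!: derivative_eq_intros)
      then have "((\<lambda>d. arcsin (sqrt 2 * d / r)) has_real_derivative sqrt 2 / w) (at x)"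
        unfolding q w_def[symmetric] using assms by (simp add: field_simps)
      from DERIV_cmult[OF this, of "r^2 / sqrt 2"] show ?thesis by simp
    qed
    ultimately have "(F has_real_derivative ((w - 2 * x^2 / w) + r^2 / w) / 2 - 2 * \<bar>x\<bar> / 2) (at x)"
      unfolding F_def by (intro DERIV_diff DERIV_add DERIV_cdivide)
    moreover have "((w - 2 * x^2 / w) + r^2 / w) / 2 - 2 * \<bar>x\<bar> / 2 = f x"
      using w unfolding f_def w_def[symmetric] by (simp add: field_simps power2_eq_square)
    ultimately show "(F has_real_derivative f x) (at x)" by simp
  qed (use * h in auto)
  also have "F h - F (-h) = r^2 * arcsin (sqrt (2 / 3)) / sqrt 2"
  proof -
    have "arcsin (- sqrt (2/3)) = - arcsin (sqrt (2/3))"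
      by (intro arcsin_minus) (auto intro: order.trans[of _ 0])
    moreover have "sqrt (r^2 - 2 * h^2) = h" using h by (intro real_sqrt_unique) auto
    ultimately show ?thesis
      using h unfolding F_def by (simp add: power2_eq_square minus_divide_left[symmetric] field_simps)
  qed
  finally show "emeasure lborel ?Q = ennreal (r^2 * arcsin (sqrt (2 / 3)) / sqrt 2)" .
qed

text \<open>Adds the degenerate radius, which occurs when the ball is scaled by 0; the region is
  then a single point.\<close>

lemma emeasure_sector:
  assumes "0 \<le> r"
  shows "emeasure lborel {(d, s). \<bar>d\<bar> \<le> s \<and> s^2 + 2 * d^2 \<le> (r::real)^2}
      = ennreal (r^2 * arcsin (sqrt (2 / 3)) / sqrt 2)"
proof (cases "r = 0")
  case True
  have "{(d, s). \<bar>d\<bar> \<le> s \<and> s^2 + 2 * d^2 \<le> r^2} = {(0, 0)}"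
  proof -
    have "a = 0 \<and> b = 0" if "b^2 + 2 * a^2 \<le> 0" for a b :: real
    proof -
      have "a^2 = 0" "b^2 = 0" using that zero_le_power2[of a] zero_le_power2[of b] by linarith+
      then show ?thesis by simp
    qed
    then show ?thesis unfolding True by auto
  qed
  then show ?thesis using True by simp
qed (use assms in \<open>simp add: emeasure_sector_pos\<close>)

lemma emeasure_wedge:
  assumes "0 \<le> l" "0 \<le> r"
  shows wedge_borel: "{(x, d, s). 0 < x \<and> x < l \<and> \<bar>d\<bar> \<le> s \<and> s^2 + 2 * d^2 \<le> (r::real)^2} \<in> sets borel"
    and "emeasure lborel {(x, d, s). 0 < x \<and> x < l \<and> \<bar>d\<bar> \<le> s \<and> s^2 + 2 * d^2 \<le> r^2}
      = ennreal (r^2 * arcsin (sqrt (2 / 3)) / sqrt 2 * l)"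
proof -
  let ?Q = "{(x, d, s). 0 < x \<and> x < l \<and> \<bar>d\<bar> \<le> s \<and> s^2 + 2 * d^2 \<le> r^2}"
  show *: "?Q \<in> sets borel"
    unfolding case_prod_unfold Collect_conj_eq
    by (intro sets.Int borel_open[OF open_Collect_less] borel_closed[OF closed_Collect_le] continuous_intros)
  define c where "c = r^2 * arcsin (sqrt (2 / 3)) / sqrt 2"
  have "0 \<le> arcsin (sqrt (2 / 3))" by (intro arcsin_nonneg) auto
  then have c: "0 \<le> c" by (simp add: c_def)
  have "emeasure lborel ?Q = ennreal (c * l - c * 0)"
  proof (rule emeasure_lborel_slices[where f = "\<lambda>_. c"
        and F = "\<lambda>x. c * x"])
    fix x assume "x \<in> {0<..<l}"
    then have "Pair x -` ?Q = {(d, s). \<bar>d\<bar> \<le> s \<and> s^2 + 2 * d^2 \<le> r^2}" by auto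
    then show "emeasure lborel (Pair x -` ?Q) = ennreal (c)"
      using assms by (simp add: emeasure_sector c_def)
  qed (use assms * c in \<open>auto intro!: derivative_eq_intros\<close>)
  then show "emeasure lborel ?Q = ennreal (r^2 * arcsin (sqrt (2 / 3)) / sqrt 2 * l)" by (simp add: c_def)
qed

section \<open>Volumes of linear images from inner products\<close>

definition lin3 :: "real ^ 3 \<Rightarrow> real ^ 3 \<Rightarrow> real ^ 3 \<Rightarrow> real ^ 3 \<Rightarrow> real ^ 3" where
  "lin3 a b c x = x $ 1 *\<^sub>R a + x $ 2 *\<^sub>R b + x $ 3 *\<^sub>R c"

text \<open>The squared determinant is the Gram determinant, so volume factors follow from inner
  products alone, without coordinates for the vectors.\<close>

lemma gram_det:
  fixes a b c :: "real ^ 3"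
  shows "(det (vector [a, b, c] :: real ^ 3 ^ 3))^2 = (a \<bullet> a) * (b \<bullet> b) * (c \<bullet> c)
    + 2 * (a \<bullet> b) * (b \<bullet> c) * (a \<bullet> c)
    - (a \<bullet> a) * (b \<bullet> c)^2 - (b \<bullet> b) * (a \<bullet> c)^2 - (c \<bullet> c) * (a \<bullet> b)^2"
  by (simp add: det_3 inner_vec_def sum_3) algebra

text \<open>The scaling factor is the absolute value of the determinant, which is the nonnegative
  root \<open>g\<close> of the Gram determinant.\<close>

lemma lin3_image:
  assumes "D \<in> lmeasurable" and "0 \<le> g"
    and g: "(a \<bullet> a) * (b \<bullet> b) * (c \<bullet> c) + 2 * (a \<bullet> b) * (b \<bullet> c) * (a \<bullet> c)
      - (a \<bullet> a) * (b \<bullet> c)^2 - (b \<bullet> b) * (a \<bullet> c)^2 - (c \<bullet> c) * (a \<bullet> b)^2 = g^2"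
  shows "(+) v ` lin3 a b c ` D \<in> lmeasurable"
    and "measure lebesgue ((+) v ` lin3 a b c ` D) = g * measure lebesgue D"
proof -
  have lin: "linear (lin3 a b c)"
    by (rule linearI) (auto simp: lin3_def algebra_simps)
  have "matrix (lin3 a b c) = transpose (vector [a, b, c])"
    by (simp add: matrix_def lin3_def transpose_def vec_eq_iff forall_3 axis_def)
  then have "\<bar>det (matrix (lin3 a b c))\<bar>^2 = g^2"
    by (simp add: det_transpose gram_det g)
  then have "\<bar>det (matrix (lin3 a b c))\<bar> = g"
    by (rule power2_eq_imp_eq) (use \<open>0 \<le> g\<close> in auto)
  then show "measure lebesgue ((+) v ` lin3 a b c ` D) = g * measure lebesgue D"
    unfolding measure_translation by (simp add: measure_linear_image[OF lin assms(1)])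
  show "(+) v ` lin3 a b c ` D \<in> lmeasurable"
    by (intro measurable_translation measurable_linear_image lin assms)
qed

lemma in_lin3_image:
  "x \<in> (+) v ` lin3 a b c ` vec3 ` {(t, u, w). P t u w}
    \<longleftrightarrow> (\<exists>t u w. P t u w \<and> x = v + (t *\<^sub>R a + u *\<^sub>R b + w *\<^sub>R c))"
  by (auto simp: image_iff lin3_def split_paired_Ex)

section \<open>The tetrahedral frame and its redundant coordinates\<close>

text \<open>A model is given by alternate vertices of the cube with coordinates 1 and -1: a regular
  tetrahedron centred at 0 with edge length \<open>2 * sqrt 2\<close>.\<close>

locale tetra_frame =
  fixes w :: "nat \<Rightarrow> real ^ 3"
  assumes inner_w: "i < 4 \<Longrightarrow> j < 4 \<Longrightarrow> w i \<bullet> w j = (if i = j then 3 else - 1)"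
begin

definition comb :: "(nat \<Rightarrow> real) \<Rightarrow> real ^ 3" where
  "comb m = (\<Sum>i<4. m i *\<^sub>R w i)"

text \<open>The inner products in the frame are 4 times the identity matrix minus the all-ones
  matrix.\<close>

lemma inner_comb: "comb m \<bullet> w j = 4 * m j - (\<Sum>i<4. m i)" if "j < 4"
proof -
  have "comb m \<bullet> w j = (\<Sum>i<4. (if i = j then 4 * m j else 0) - m i)"
    unfolding comb_def inner_sum_left using that by (intro sum.cong) (auto simp: inner_w)
  then show ?thesis using that by (simp add: sum_subtractf)
qed

lemma norm_comb: "(norm (comb m))^2 = 4 * (\<Sum>i<4. (m i)^2) - (\<Sum>i<4. m i)^2"
proof -
  have "(norm (comb m))^2 = (\<Sum>j<4. m j * (comb m \<bullet> w j))"
    unfolding power2_norm_eq_inner by (subst (2) comb_def) (simp add: inner_sum_right)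
  also have "\<dots> = (\<Sum>j<4. 4 * (m j)^2 - m j * (\<Sum>i<4. m i))"
    by (intro sum.cong) (auto simp: inner_comb algebra_simps power2_eq_square)
  also have "\<dots> = 4 * (\<Sum>i<4. (m i)^2) - (\<Sum>i<4. m i)^2"
    unfolding sum_subtractf sum_distrib_left[symmetric] sum_distrib_right[symmetric]
    by (simp add: power2_eq_square)
  finally show ?thesis .
qed

lemma comb_add: "comb (\<lambda>i. f i + g i) = comb f + comb g"
  by (simp add: comb_def scaleR_add_left sum.distrib)

lemma comb_cong: "(\<And>i. i < 4 \<Longrightarrow> f i = g i) \<Longrightarrow> comb f = comb g"
  by (simp add: comb_def)

lemma comb_scale: "comb (\<lambda>i. c * f i) = c *\<^sub>R comb f"
  by (simp add: comb_def scaleR_sum_right)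

text \<open>The frame vectors sum to 0, so adding a common constant to all coefficients does not
  move the point. This freedom is what \<open>rep\<close> fixes.\<close>

lemma comb_const: "comb (\<lambda>_. c) = 0"
proof -
  have "(norm (comb (\<lambda>_. c)))^2 = 0" by (subst norm_comb) (simp add: power2_eq_square)
  then show ?thesis by simp
qed

text \<open>Three of the frame vectors already form a basis, because their Gram determinant is
  16.\<close>

lemma eq_0_if_orthogonal:
  assumes "\<And>j. j < 4 \<Longrightarrow> y \<bullet> w j = 0"
  shows "y = 0"
proof -
  let ?A = "vector [w 0, w 1, w 2] :: real ^ 3 ^ 3"
  have "(det ?A)^2 = 16"
    by (simp add: gram_det inner_w)
  then have "invertible ?A" by (auto simp: invertible_det_nz)
  moreover have "?A *v y = 0"
    using assms by (simp add: vec_eq_iff forall_3 matrix_vector_mul_component inner_commute)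
  ultimately show ?thesis
    by (metis invertible_def matrix_left_invertible_ker)
qed

text \<open>These coefficients sum to 0, so by \<open>inner_comb\<close> both sides have the same
  inner product with every frame vector.\<close>

lemma comb_repr: "comb (\<lambda>i. x \<bullet> w i / 4) = x"
proof -
  have "(\<Sum>i<4. x \<bullet> w i) = x \<bullet> comb (\<lambda>_. 1)"
    by (simp add: comb_def inner_sum_right)
  then have s: "(\<Sum>i<4. x \<bullet> w i / 4) = 0"
    by (simp add: comb_const sum_divide_distrib[symmetric])
  have "comb (\<lambda>i. x \<bullet> w i / 4) - x = 0"
    by (rule eq_0_if_orthogonal) (simp add: inner_diff_left inner_comb s)
  then show ?thesis by simp
qed

text \<open>The point \<open>x\<close> is the sum of its nearest point \<open>comb (max 0 \<circ> m)\<close> in the tetrahedron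
  with vertices \<open>\<sigma> w\<^sub>i\<close> and of the vector \<open>comb (min 0 \<circ> m)\<close> in the normal cone there.\<close>
definition rep :: "real \<Rightarrow> real ^ 3 \<Rightarrow> (nat \<Rightarrow> real) \<Rightarrow> bool" where
  "rep \<sigma> x m \<longleftrightarrow> x = comb m \<and> (\<Sum>i<4. max 0 (m i)) = \<sigma>"

text \<open>A common shift \<open>t\<close> of the coefficients keeps the point, while the sum of
  their positive parts varies continuously from 0 to at least \<open>\<sigma>\<close>; the
  intermediate value theorem gives the shift.\<close>

lemma rep_exists:
  assumes "0 \<le> \<sigma>"
  shows "\<exists>m. rep \<sigma> x m"
proof -
  define m where "m i = x \<bullet> w i / 4" for i
  define g where "g t = (\<Sum>i<4. max 0 (m i + t))" for t
  define b where "b = (\<Sum>i<4. \<bar>m i\<bar>)"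
  have b: "\<bar>m i\<bar> \<le> b" if "i < 4" for i
    unfolding b_def using that by (intro member_le_sum) auto
  have "g (- b) = 0"
    unfolding g_def using b by (intro sum.neutral) (fastforce simp: abs_le_iff)
  moreover have "\<sigma> \<le> g (b + \<sigma>)"
  proof -
    have "\<sigma> \<le> max 0 (m 0 + (b + \<sigma>))" using b[of 0] by simp
    also have "\<dots> \<le> g (b + \<sigma>)" unfolding g_def by (intro member_le_sum) auto
    finally show ?thesis .
  qed
  moreover have "0 \<le> b" unfolding b_def by (intro sum_nonneg) auto
  moreover have "continuous_on {- b..b + \<sigma>} g" unfolding g_def by (intro continuous_intros)
  ultimately obtain t where "g t = \<sigma>" using assms IVT'[of g "- b" \<sigma> "b + \<sigma>"] by auto
  moreover have "comb (\<lambda>i. m i + t) = x"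
    by (simp add: comb_add comb_const m_def comb_repr)
  ultimately show ?thesis unfolding rep_def g_def by metis
qed

text \<open>Two representations of a point differ by a common shift. As \<open>0 < \<sigma>\<close>,
  some coefficient is positive, so an upward shift would strictly increase the sum of positive
  parts.\<close>

lemma rep_unique:
  assumes "0 < \<sigma>" "rep \<sigma> x m" "rep \<sigma> x m'" "i < 4"
  shows "m i = m' i"
proof -
  have less: False
    if "rep \<sigma> x m" "rep \<sigma> x m'" and shift: "\<And>i. i < 4 \<Longrightarrow> m' i = m i + t" and "0 < t" for m m' t
  proof -
    have "\<exists>i<4. 0 < m i"
    proof (rule ccontr)
      assume "\<not> (\<exists>i<4. 0 < m i)"
      then have "(\<Sum>i<4. max 0 (m i)) = 0" by (intro sum.neutral) (fastforce simp: not_less intro: max_absorb1)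
      then show False using that assms by (simp add: rep_def)
    qed
    then obtain i where "i < 4" "0 < m i" by auto
    then have "(\<Sum>i<4. max 0 (m i)) < (\<Sum>i<4. max 0 (m' i))"
      using \<open>0 < t\<close> by (intro sum_strict_mono_ex1) (auto simp: shift intro!: bexI[of _ i])
    then show False using that by (simp add: rep_def)
  qed
  define t where "t = ((\<Sum>i<4. m' i) - (\<Sum>i<4. m i)) / 4"
  have "m' j = m j + t" if "j < 4" for j
  proof -
    have "comb m = comb m'" using assms(2,3) by (simp add: rep_def)
    then have "4 * m j - (\<Sum>i<4. m i) = 4 * m' j - (\<Sum>i<4. m' i)"
      using inner_comb[OF that] by metis
    then show ?thesis by (simp add: t_def field_simps)
  qed
  then have "m' j = m j + t" "m j = m' j + - t" if "j < 4" for j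
    using that by auto
  then have "\<not> 0 < t" "\<not> 0 < - t"
    using less[of m m' t] less[of m' m "- t"] assms(2,3) by blast+
  then have "t = 0" by simp
  then show ?thesis using \<open>\<And>j. j < 4 \<Longrightarrow> m' j = m j + t\<close> assms(4) by simp
qed

section \<open>The parallel body and its decomposition by faces\<close>

text \<open>The outer parallel body at distance \<open>r\<close> of the tetrahedron with vertices
  \<open>\<sigma> *\<^sub>R w i\<close>.\<close>

definition body :: "real \<Rightarrow> real \<Rightarrow> (real ^ 3) set" where
  "body \<sigma> r = {comb m + q | m q. (\<forall>i<4. 0 \<le> m i) \<and> (\<Sum>i<4. m i) = \<sigma> \<and> norm q \<le> r}"

text \<open>The negative part \<open>?n\<close> is the shortest displacement: the vector
  \<open>d\<close> from any other point of the tetrahedron to the nearest one has nonnegative inner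
  product with \<open>?n\<close>, so \<open>d + ?n\<close> is at least as long as
  \<open>?n\<close>.\<close>

lemma in_body_iff:
  assumes "rep \<sigma> x m"
  shows "x \<in> body \<sigma> r \<longleftrightarrow> norm (comb (\<lambda>i. min 0 (m i))) \<le> r"
proof
  have x: "x = comb (\<lambda>i. max 0 (m i)) + comb (\<lambda>i. min 0 (m i))"
    unfolding comb_add[symmetric] using assms by (auto simp: rep_def intro!: comb_cong)
  then show "x \<in> body \<sigma> r" if "norm (comb (\<lambda>i. min 0 (m i))) \<le> r"
    unfolding body_def using that assms by (fastforce simp: rep_def)
  assume "x \<in> body \<sigma> r"
  then obtain l q where l: "x = comb l + q" "\<And>i. i < 4 \<Longrightarrow> 0 \<le> l i" "(\<Sum>i<4. l i) = \<sigma>" "norm q \<le> r"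
    unfolding body_def by auto
  let ?n = "comb (\<lambda>i. min 0 (m i))"
  define d where "d = comb (\<lambda>i. max 0 (m i) - l i)"
  have q: "q = d + ?n"
    using x l(1) unfolding d_def by (simp add: comb_def scaleR_diff_left sum_subtractf algebra_simps)
  have "d \<bullet> ?n = (\<Sum>j<4. min 0 (m j) * (d \<bullet> w j))"
    by (simp add: comb_def inner_sum_right)
  also have "\<dots> = (\<Sum>j<4. - 4 * (min 0 (m j) * l j))"
  proof (intro sum.cong refl)
    fix j :: nat assume "j \<in> {..<4}"
    then have "d \<bullet> w j = 4 * (max 0 (m j) - l j)"
      using assms l(3) by (simp add: d_def inner_comb sum_subtractf rep_def)
    \<comment> \<open>The positive and negative parts of one coefficient have product 0, so only the
      term with \<open>l j\<close> survives.\<close>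
    then show "min 0 (m j) * (d \<bullet> w j) = - 4 * (min 0 (m j) * l j)"
      by (simp add: min_def max_def)
  qed
  also have "\<dots> \<ge> 0"
    using l(2) by (intro sum_nonneg) (auto simp: mult_nonpos_nonneg mult_nonneg_nonpos)
  finally have "0 \<le> d \<bullet> ?n" .
  then have "(norm ?n)^2 \<le> (norm q)^2"
    unfolding q power2_norm_eq_inner by (simp add: inner_add_left inner_add_right inner_commute)
  then have "norm ?n \<le> norm q" by simp
  then show "norm ?n \<le> r" using l(4) by simp
qed

text \<open>For \<open>0 < \<sigma>\<close>, the points whose nearest point in the tetrahedron lies
  in the relative interior of the face with vertex set \<open>I\<close>.\<close>

definition piece :: "real \<Rightarrow> real \<Rightarrow> nat set \<Rightarrow> (real ^ 3) set" where
  "piece \<sigma> r I = {x. \<exists>m. rep \<sigma> x m \<and> norm (comb (\<lambda>i. min 0 (m i))) \<le> r \<and> {i. i < 4 \<and> 0 < m i} = I}"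

lemma body_eq_pieces: "body \<sigma> r = (\<Union>I\<in>Pow {..<4}. piece \<sigma> r I)" if pos: "0 < \<sigma>"
proof (intro set_eqI iffI)
  fix x
  obtain m where m: "rep \<sigma> x m" using rep_exists[of \<sigma> x] pos by auto
  assume "x \<in> body \<sigma> r"
  then show "x \<in> (\<Union>I\<in>Pow {..<4}. piece \<sigma> r I)"
    unfolding in_body_iff[OF m] using m by (auto simp: piece_def intro!: bexI[of _ "{i. i < 4 \<and> 0 < m i}"])
qed (auto simp: piece_def in_body_iff)

lemma piece_disjoint: "piece \<sigma> r I \<inter> piece \<sigma> r J = {}" if "0 < \<sigma>" "I \<noteq> J"
proof (rule ccontr)
  assume "piece \<sigma> r I \<inter> piece \<sigma> r J \<noteq> {}"
  then obtain x m m' where m: "rep \<sigma> x m" "rep \<sigma> x m'"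
    and I: "{i. i < 4 \<and> 0 < m i} = I" and J: "{i. i < 4 \<and> 0 < m' i} = J"
    unfolding piece_def by blast
  have "m i = m' i" if "i < 4" for i
    using rep_unique[OF \<open>0 < \<sigma>\<close> m that] .
  then have "I = J" unfolding I[symmetric] J[symmetric] by auto
  then show False using that(2) by simp
qed

lemma piece_empty: "piece \<sigma> r {} = {}" if "0 < \<sigma>"
proof -
  have "(\<Sum>i<4. max 0 (m i)) = 0" if "{i. i < 4 \<and> 0 < m i} = {}" for m :: "nat \<Rightarrow> real"
    using that by (intro sum.neutral) (fastforce simp: not_less intro: max_absorb1)
  then have "\<not> rep \<sigma> x m" if "{i. i < 4 \<and> 0 < m i} = {}" for x m
    using that \<open>0 < \<sigma>\<close> unfolding rep_def by (metis less_irrefl)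
  then show ?thesis unfolding piece_def by blast
qed

text \<open>Trades the coefficient function for four real numbers. The order of the indices is
  arbitrary, so one computation serves all faces of the same dimension.\<close>

lemma piece_char:
  assumes S: "{..<4} = {i, j, k, l}" and "distinct [i, j, k, l]" and "I \<subseteq> {..<4}"
  shows "x \<in> piece \<sigma> r I \<longleftrightarrow> (\<exists>a b c d. x = a *\<^sub>R w i + b *\<^sub>R w j + c *\<^sub>R w k + d *\<^sub>R w l \<and>
    max 0 a + max 0 b + max 0 c + max 0 d = \<sigma> \<and>
    norm (min 0 a *\<^sub>R w i + min 0 b *\<^sub>R w j + min 0 c *\<^sub>R w k + min 0 d *\<^sub>R w l) \<le> r \<and>
    (0 < a \<longleftrightarrow> i \<in> I) \<and> (0 < b \<longleftrightarrow> j \<in> I) \<and> (0 < c \<longleftrightarrow> k \<in> I) \<and> (0 < d \<longleftrightarrow> l \<in> I))"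
    (is "_ \<longleftrightarrow> (\<exists>a b c d. ?P a b c d)")
proof -
  have I: "{i. i < 4 \<and> 0 < m i} = I \<longleftrightarrow> (\<forall>i\<in>{..<4}. 0 < m i \<longleftrightarrow> i \<in> I)" for m :: "nat \<Rightarrow> real"
    using assms(3) by auto
  have sum4: "sum f {..<4} = f i + f j + f k + f l" for f :: "nat \<Rightarrow> 'b::comm_monoid_add"
    unfolding S using assms(2) by (simp add: add.assoc)
  have "x \<in> piece \<sigma> r I \<longleftrightarrow> (\<exists>m. ?P (m i) (m j) (m k) (m l))"
    unfolding piece_def rep_def I comb_def sum4 by (simp add: S)
  also have "\<dots> \<longleftrightarrow> (\<exists>a b c d. ?P a b c d)"
  proof
    assume "\<exists>a b c d. ?P a b c d"
    then obtain a b c d where "?P a b c d" by blast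
    then have "?P (m i) (m j) (m k) (m l)" if "m = (\<lambda>_. 0)(i := a, j := b, k := c, l := d)" for m
      using assms(2) that by simp
    then show "\<exists>m. ?P (m i) (m j) (m k) (m l)" by blast
  qed blast
  finally show ?thesis .
qed

lemma pieceI:
  assumes "{..<4} = {i, j, k, l}" "distinct [i, j, k, l]" "I \<subseteq> {..<4}"
    and "x = a *\<^sub>R w i + b *\<^sub>R w j + c *\<^sub>R w k + d *\<^sub>R w l"
    and "max 0 a + max 0 b + max 0 c + max 0 d = \<sigma>"
    and "norm (min 0 a *\<^sub>R w i + min 0 b *\<^sub>R w j + min 0 c *\<^sub>R w k + min 0 d *\<^sub>R w l) \<le> r"
    and "0 < a \<longleftrightarrow> i \<in> I" "0 < b \<longleftrightarrow> j \<in> I" "0 < c \<longleftrightarrow> k \<in> I" "0 < d \<longleftrightarrow> l \<in> I"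
  shows "x \<in> piece \<sigma> r I"
  unfolding piece_char[OF assms(1-3)]
  by (intro exI[of _ a] exI[of _ b] exI[of _ c] exI[of _ d] conjI assms(4-))

section \<open>Volumes of the pieces\<close>

text \<open>Nothing is displaced here. The three edge vectors at one vertex have squared length 8
  and mutual inner products 4, which gives the factor 16 on the simplex of volume
  \<open>\<sigma>^3 / 6\<close>.\<close>

lemma measure_piece4:
  assumes "0 \<le> \<sigma>" "0 \<le> r"
  shows "piece \<sigma> r {..<4} \<in> lmeasurable" "measure lebesgue (piece \<sigma> r {..<4}) = 8 / 3 * \<sigma>^3"
proof -
  let ?Q = "{(x, y, z). 0 < x \<and> 0 < y \<and> 0 < z \<and> x + y + z < \<sigma>}"
  let ?L = "(+) (\<sigma> *\<^sub>R w 3) ` lin3 (w 0 - w 3) (w 1 - w 3) (w 2 - w 3) ` vec3 ` ?Q"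
  have S: "{..<4} = {0, 1, 2, 3::nat}" by auto
  have "piece \<sigma> r {..<4} = ?L"
  proof (intro set_eqI iffI)
    fix x assume "x \<in> piece \<sigma> r {..<4}"
    then obtain a b c d where *: "x = a *\<^sub>R w 0 + b *\<^sub>R w 1 + c *\<^sub>R w 2 + d *\<^sub>R w 3"
      "a + b + c + d = \<sigma>" "0 < a" "0 < b" "0 < c" "0 < d"
      by (subst (asm) piece_char[OF S]) auto
    then have "d = \<sigma> - a - b - c" by simp
    with * show "x \<in> ?L"
      unfolding in_lin3_image by (intro exI[of _ a] exI[of _ b] exI[of _ c]) (auto simp: algebra_simps)
  next
    fix x assume "x \<in> ?L"
    then obtain a b c where *: "0 < a" "0 < b" "0 < c" "a + b + c < \<sigma>"
      "x = \<sigma> *\<^sub>R w 3 + (a *\<^sub>R (w 0 - w 3) + b *\<^sub>R (w 1 - w 3) + c *\<^sub>R (w 2 - w 3))"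
      unfolding in_lin3_image by auto
    then show "x \<in> piece \<sigma> r {..<4}"
      using assms by (intro pieceI[OF S, of _ _ a b c "\<sigma> - a - b - c"]) (auto simp: algebra_simps)
  qed
  moreover note Q = measure_vec3_image[OF simplex_borel emeasure_simplex(2), OF assms(1) assms(1)]
  ultimately show "piece \<sigma> r {..<4} \<in> lmeasurable" "measure lebesgue (piece \<sigma> r {..<4}) = 8 / 3 * \<sigma>^3"
    using assms lin3_image[OF Q(1), of 16 "w 0 - w 3" "w 1 - w 3" "w 2 - w 3"] Q(2)
    by (auto simp: inner_diff_left inner_diff_right inner_w)
qed

text \<open>A prism over the face opposite to \<open>w l\<close>. Its height vector
  \<open>- w l\<close> has length \<open>sqrt 3\<close> and is orthogonal to the face, so the height
  parameter stops at \<open>r / sqrt 3\<close> and the factor is 12.\<close>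

lemma measure_piece3:
  assumes "0 \<le> \<sigma>" "0 \<le> r" and S: "{..<4} = {i, j, k, l}" and d: "distinct [i, j, k, l]"
  shows "piece \<sigma> r {i, j, k} \<in> lmeasurable" "measure lebesgue (piece \<sigma> r {i, j, k}) = 2 * sqrt 3 * \<sigma>^2 * r"
proof -
  let ?Q = "{(z, x, y). 0 \<le> z \<and> z \<le> r / sqrt 3 \<and> 0 < x \<and> 0 < y \<and> x + y < \<sigma>}"
  let ?L = "(+) (\<sigma> *\<^sub>R w k) ` lin3 (- w l) (w i - w k) (w j - w k) ` vec3 ` ?Q"
  have lt: "i < 4" "j < 4" "k < 4" "l < 4" using S by auto
  have sub: "{i, j, k} \<subseteq> {..<4}" using S by auto
  have "norm (w l) = sqrt 3" using lt by (simp add: norm_eq_sqrt_inner inner_w)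
  then have n: "norm (z *\<^sub>R w l) \<le> r \<longleftrightarrow> \<bar>z\<bar> \<le> r / sqrt 3" for z
    by (simp add: field_simps)
  have "piece \<sigma> r {i, j, k} = ?L"
  proof (intro set_eqI iffI)
    fix x assume "x \<in> piece \<sigma> r {i, j, k}"
    then obtain a b c d where *: "x = a *\<^sub>R w i + b *\<^sub>R w j + c *\<^sub>R w k + d *\<^sub>R w l"
      "a + b + c = \<sigma>" "norm (d *\<^sub>R w l) \<le> r" "0 < a" "0 < b" "0 < c" "d \<le> 0"
      using d by (subst (asm) piece_char[OF S d sub]) (auto simp: not_less)
    then have "c = \<sigma> - a - b" by simp
    with * show "x \<in> ?L"
      unfolding in_lin3_image n by (intro exI[of _ "-d"] exI[of _ a] exI[of _ b]) (auto simp: algebra_simps)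
  next
    fix x assume "x \<in> ?L"
    then obtain z a b where *: "0 \<le> z" "z \<le> r / sqrt 3" "0 < a" "0 < b" "a + b < \<sigma>"
      "x = \<sigma> *\<^sub>R w k + (z *\<^sub>R - w l + a *\<^sub>R (w i - w k) + b *\<^sub>R (w j - w k))"
      unfolding in_lin3_image by blast
    moreover from * have "norm ((- z) *\<^sub>R w l) \<le> r" unfolding n by simp
    ultimately show "x \<in> piece \<sigma> r {i, j, k}"
      using d by (intro pieceI[OF S d sub, of _ a b "\<sigma> - a - b" "- z"]) (auto simp: algebra_simps)
  qed
  moreover have r3: "0 \<le> r / sqrt 3" using assms by simp
  moreover note Q = measure_vec3_image[OF prism_borel emeasure_prism(2), OF assms(1) r3 assms(1) r3]
  moreover have "12 * (\<sigma>^2 / 2 * (r / sqrt 3)) = 2 * sqrt 3 * \<sigma>^2 * r"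
    by (simp add: field_simps)
  ultimately show "piece \<sigma> r {i, j, k} \<in> lmeasurable"
    "measure lebesgue (piece \<sigma> r {i, j, k}) = 2 * sqrt 3 * \<sigma>^2 * r"
    using assms(1,2) lin3_image[OF Q(1), of 12 "- w l" "w i - w k" "w j - w k"] Q(2) d
    by (simp_all add: inner_diff_left inner_diff_right inner_w lt)
qed

text \<open>A wedge along the edge from \<open>w i\<close> to \<open>w j\<close>. For the
  displacement \<open>c *\<^sub>R w k + e *\<^sub>R w l\<close>, the coordinates
  \<open>s = - c - e\<close> and \<open>d = e - c\<close> diagonalise the squared norm and turn
  \<open>c \<le> 0\<close>, \<open>e \<le> 0\<close> into \<open>\<bar>d\<bar> \<le> s\<close>. The
  three spanning vectors are orthogonal with squared lengths 8, 2 and 1, hence the factor 4.\<close>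

lemma measure_piece2:
  assumes "0 \<le> \<sigma>" "0 \<le> r" and S: "{..<4} = {i, j, k, l}" and d: "distinct [i, j, k, l]"
  shows "piece \<sigma> r {i, j} \<in> lmeasurable"
    "measure lebesgue (piece \<sigma> r {i, j}) = 4 * (r^2 * arcsin (sqrt (2 / 3)) / sqrt 2 * \<sigma>)"
proof -
  let ?Q = "{(x, d, s). 0 < x \<and> x < \<sigma> \<and> \<bar>d\<bar> \<le> s \<and> s^2 + 2 * d^2 \<le> r^2}"
  let ?L = "(+) (\<sigma> *\<^sub>R w j) ` lin3 (w i - w j) ((1/2) *\<^sub>R (w l - w k)) (- (1/2) *\<^sub>R (w k + w l)) ` vec3 ` ?Q"
  have lt: "i < 4" "j < 4" "k < 4" "l < 4" using S by auto
  have sub: "{i, j} \<subseteq> {..<4}" using S by auto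
  have n: "norm (c *\<^sub>R w k + e *\<^sub>R w l) \<le> r \<longleftrightarrow> (c + e)^2 + 2 * (c - e)^2 \<le> r^2" for c e
  proof -
    have "norm (c *\<^sub>R w k + e *\<^sub>R w l) \<le> r \<longleftrightarrow> norm (c *\<^sub>R w k + e *\<^sub>R w l)^2 \<le> r^2"
      using \<open>0 \<le> r\<close> by (simp add: abs_le_square_iff[symmetric])
    then show ?thesis
      using lt d unfolding power2_norm_eq_inner
      by (simp add: inner_add_left inner_add_right inner_w power2_eq_square algebra_simps)
  qed
  have "piece \<sigma> r {i, j} = ?L"
  proof (intro set_eqI iffI)
    fix x assume "x \<in> piece \<sigma> r {i, j}"
    then obtain a b c e where *: "x = a *\<^sub>R w i + b *\<^sub>R w j + c *\<^sub>R w k + e *\<^sub>R w l"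
      "a + b = \<sigma>" "norm (c *\<^sub>R w k + e *\<^sub>R w l) \<le> r" "0 < a" "0 < b" "c \<le> 0" "e \<le> 0"
      using d by (subst (asm) piece_char[OF S d sub]) (auto simp: not_less)
    then have b: "b = \<sigma> - a" by simp
    have "x = \<sigma> *\<^sub>R w j + (a *\<^sub>R (w i - w j) + (e - c) *\<^sub>R (1/2) *\<^sub>R (w l - w k) + (- c - e) *\<^sub>R (- (1/2)) *\<^sub>R (w k + w l))"
      unfolding *(1) b by (simp add: vec_eq_iff) (simp add: field_simps)
    with * b show "x \<in> ?L"
      unfolding in_lin3_image n
      by (intro exI[of _ a] exI[of _ "e - c"] exI[of _ "- c - e"])
         (auto simp: power2_eq_square algebra_simps)
  next
    fix x assume "x \<in> ?L"
    then obtain a t s where *: "0 < a" "a < \<sigma>" "\<bar>t\<bar> \<le> s" "s^2 + 2 * t^2 \<le> r^2"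
      and x: "x = \<sigma> *\<^sub>R w j + (a *\<^sub>R (w i - w j) + t *\<^sub>R (1/2) *\<^sub>R (w l - w k) + s *\<^sub>R (- (1/2)) *\<^sub>R (w k + w l))"
      unfolding in_lin3_image by blast
    define c e where "c = - (s + t) / 2" and "e = - (s - t) / 2"
    have ce: "c \<le> 0" "e \<le> 0" using *(3) by (auto simp: c_def e_def)
    have "s^2 = (c + e)^2" "t^2 = (c - e)^2"
      by (simp_all add: c_def e_def power2_eq_square field_simps)
    then have le: "norm (c *\<^sub>R w k + e *\<^sub>R w l) \<le> r" unfolding n using *(4) by simp
    have "x = a *\<^sub>R w i + (\<sigma> - a) *\<^sub>R w j + c *\<^sub>R w k + e *\<^sub>R w l"
      unfolding x c_def e_def by (simp add: vec_eq_iff) (simp add: field_simps)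
    then show "x \<in> piece \<sigma> r {i, j}"
      using d ce le * by (intro pieceI[OF S d sub, of _ a "\<sigma> - a" c e]) auto
  qed
  moreover note Q = measure_vec3_image[OF wedge_borel emeasure_wedge(2), OF assms(1,2) assms(1,2)]
  moreover have "0 \<le> arcsin (sqrt (2 / 3))" by (intro arcsin_nonneg) auto
  ultimately show "piece \<sigma> r {i, j} \<in> lmeasurable"
    "measure lebesgue (piece \<sigma> r {i, j}) = 4 * (r^2 * arcsin (sqrt (2 / 3)) / sqrt 2 * \<sigma>)"
    using assms(1,2) lin3_image[OF Q(1), of 4 "w i - w j" "(1/2) *\<^sub>R (w l - w k)" "- (1/2) *\<^sub>R (w k + w l)"] Q(2) d
    by (auto simp: inner_diff_left inner_diff_right inner_add_left inner_add_right inner_w lt power2_eq_square)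
qed

text \<open>The part of the ball in the normal cone at vertex \<open>i\<close>: the vectors whose
  inner product is largest at that vertex.\<close>

definition cone_sector :: "real \<Rightarrow> nat \<Rightarrow> (real ^ 3) set" where
  "cone_sector r i = {y \<in> cball 0 r. \<forall>j<4. y \<bullet> w j \<le> y \<bullet> w i}"

lemma piece1:
  assumes S: "{..<4} = {i, j, k, l}" and d: "distinct [i, j, k, l]" and "0 < \<sigma>"
  shows "piece \<sigma> r {i} = (+) (\<sigma> *\<^sub>R w i) ` cone_sector r i"
proof -
  have lt: "i < 4" "j < 4" "k < 4" "l < 4" using S by auto
  have sub: "{i} \<subseteq> {..<4}" using S by auto
  have all: "(\<forall>j<4. P j) \<longleftrightarrow> P i \<and> P j \<and> P k \<and> P l" for P :: "nat \<Rightarrow> bool"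
    using S by (metis insert_iff lessThan_iff singletonD)
  show ?thesis
  proof (intro set_eqI iffI)
    fix x assume "x \<in> piece \<sigma> r {i}"
    then obtain b c e where *: "x = \<sigma> *\<^sub>R w i + b *\<^sub>R w j + c *\<^sub>R w k + e *\<^sub>R w l"
      "norm (b *\<^sub>R w j + c *\<^sub>R w k + e *\<^sub>R w l) \<le> r" "b \<le> 0" "c \<le> 0" "e \<le> 0"
      using d by (subst (asm) piece_char[OF S d sub]) (auto simp: not_less)
    define y where "y = b *\<^sub>R w j + c *\<^sub>R w k + e *\<^sub>R w l"
    have "y \<in> cone_sector r i"
      unfolding cone_sector_def all using * d lt by (auto simp: y_def inner_add_left inner_w)
    moreover have "x = \<sigma> *\<^sub>R w i + y" using * by (simp add: y_def)
    ultimately show "x \<in> (+) (\<sigma> *\<^sub>R w i) ` cone_sector r i" by blast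
  next
    fix x assume "x \<in> (+) (\<sigma> *\<^sub>R w i) ` cone_sector r i"
    then obtain y where x: "x = \<sigma> *\<^sub>R w i + y" and y: "norm y \<le> r"
      "y \<bullet> w j \<le> y \<bullet> w i" "y \<bullet> w k \<le> y \<bullet> w i" "y \<bullet> w l \<le> y \<bullet> w i"
      unfolding cone_sector_def all by auto
    \<comment> \<open>The coefficients of \<open>comb_repr\<close> shifted so that the one at
      \<open>i\<close> vanishes; the cone condition says that the others are not positive.\<close>
    define m where "m n = (y \<bullet> w n - y \<bullet> w i) / 4" for n
    have m: "m i = 0" "m j \<le> 0" "m k \<le> 0" "m l \<le> 0" using y by (auto simp: m_def)
    have "comb m = comb (\<lambda>n. y \<bullet> w n / 4) + comb (\<lambda>_. - (y \<bullet> w i / 4))"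
      unfolding comb_add[symmetric] by (simp add: m_def[abs_def] diff_divide_distrib)
    then have "y = comb m" by (simp add: comb_repr comb_const)
    also have "\<dots> = m j *\<^sub>R w j + m k *\<^sub>R w k + m l *\<^sub>R w l"
      unfolding comb_def S using d m(1) by (simp add: add.assoc)
    finally have y': "y = m j *\<^sub>R w j + m k *\<^sub>R w k + m l *\<^sub>R w l" .
    then have "norm (m j *\<^sub>R w j + m k *\<^sub>R w k + m l *\<^sub>R w l) \<le> r" using y(1) by simp
    then show "x \<in> piece \<sigma> r {i}"
      unfolding x using d m \<open>0 < \<sigma>\<close>
      by (intro pieceI[OF S d sub, of _ \<sigma> "m j" "m k" "m l"]) (use y' in \<open>auto simp: add.assoc\<close>)
  qed
qed

lemma cone_sector_lmeasurable: "cone_sector r i \<in> lmeasurable"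
proof (rule lmeasurable_compact)
  have "cone_sector r i = cball 0 r \<inter> (\<Inter>j\<in>{..<4}. {y. y \<bullet> w j \<le> y \<bullet> w i})"
    by (auto simp: cone_sector_def)
  then show "compact (cone_sector r i)"
    by (simp add: compact_Int_closed closed_INT closed_Collect_le continuous_intros)
qed

text \<open>Each vector belongs to the sector of an index maximising the inner product, and two
  sectors overlap only in a hyperplane. Only this total is required, so no single sector is
  measured.\<close>

lemma sum_measure_cone_sector: "(\<Sum>i<4. measure lebesgue (cone_sector r i)) = measure lebesgue (cball 0 r :: (real ^ 3) set)"
proof -
  have "(\<Union>i<4. cone_sector r i) = cball 0 r"
  proof (intro set_eqI iffI)
    fix y :: "real ^ 3" assume y: "y \<in> cball 0 r"
    have "Max ((\<lambda>j. y \<bullet> w j) ` {..<4}) \<in> (\<lambda>j. y \<bullet> w j) ` {..<4}"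
      by (intro Max_in) (auto simp: lessThan_empty_iff)
    then obtain i where i: "i < 4" "Max ((\<lambda>j. y \<bullet> w j) ` {..<4}) = y \<bullet> w i" by auto
    have "y \<bullet> w j \<le> y \<bullet> w i" if "j < 4" for j
      unfolding i(2)[symmetric] using that by (intro Max_ge) auto
    then show "y \<in> (\<Union>i<4. cone_sector r i)" using i y by (auto simp: cone_sector_def)
  qed (auto simp: cone_sector_def)
  moreover have "negligible (cone_sector r i \<inter> cone_sector r j)" if "i < 4" "j < 4" "i \<noteq> j" for i j
  proof (rule negligible_subset)
    have "w i - w j \<noteq> 0"
    proof
      assume "w i - w j = 0"
      then have "(w i - w j) \<bullet> w i = 0" by simp
      then show False using that by (simp add: inner_diff_left inner_w)
    qed
    then show "negligible {y. (w i - w j) \<bullet> y = 0}" by (intro negligible_hyperplane) auto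
    show "cone_sector r i \<inter> cone_sector r j \<subseteq> {y. (w i - w j) \<bullet> y = 0}"
      using that by (auto simp: cone_sector_def inner_diff_right inner_commute intro: order.antisym)
  qed
  ultimately show ?thesis
    using measure_negligible_finite_Union_image[of "{..<4}" "cone_sector r"]
    by (simp add: cone_sector_lmeasurable pairwise_def)
qed

section \<open>Steiner's formula\<close>

text \<open>Treated apart because \<open>rep\<close> is not unique for \<open>\<sigma> = 0\<close>;
  it is the case in which the tetrahedron is scaled by 0.\<close>

lemma body_0: "body 0 r = cball 0 r"
proof -
  have "comb m = 0" if "\<forall>i<4. 0 \<le> m i" "(\<Sum>i<4. m i) = 0" for m
    using that sum_nonneg_eq_0_iff[of "{..<4}" m] by (simp add: comb_def)
  moreover have "comb (\<lambda>_. 0) = 0" by (simp add: comb_def)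
  ultimately show ?thesis
    unfolding body_def by (fastforce intro!: exI[of _ "\<lambda>_. 0"])
qed

lemma measure_body:
  assumes "0 \<le> \<sigma>" "0 \<le> r"
  shows "measure lebesgue (body \<sigma> r) = 8 / 3 * \<sigma>^3 + 8 * sqrt 3 * \<sigma>^2 * r
    + 12 * sqrt 2 * arcsin (sqrt (2 / 3)) * \<sigma> * r^2 + 4 / 3 * pi * r^3"
proof -
  let ?\<mu> = "\<lambda>I. measure lebesgue (piece \<sigma> r I)"
  have ball: "measure lebesgue (cball 0 r :: (real ^ 3) set) = 4 / 3 * pi * r^3"
  proof -
    have "measure lborel (cball 0 r :: (real ^ 3) set) = measure lborel (ball 0 r :: (real ^ 3) set)"
      using assms(2) by (simp only: content_ball content_cball)
    then show ?thesis using sphere_volume[OF assms(2), of "0 :: real ^ 3"] by simp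
  qed
  show ?thesis
  proof (cases "\<sigma> = 0")
    case True
    then show ?thesis by (simp add: body_0 ball)
  next
    case False
    then have pos: "0 < \<sigma>" using assms by simp
    let ?S = "{..<4::nat}"
    have split: "?S = I \<union> (?S - I)" "I \<inter> (?S - I) = {}" if "I \<subseteq> ?S" for I
      using that by blast+
    have c1: "\<exists>j k l. ?S = {i, j, k, l} \<and> distinct [i, j, k, l]" if "i < 4" for i
    proof -
      have "card (?S - {i}) = 3" using that by simp
      then obtain j k l where jkl: "?S - {i} = {j, k, l}" "j \<noteq> k" "k \<noteq> l" "j \<noteq> l"
        unfolding card_3_iff by blast
      have "{i} \<subseteq> ?S" using that by simp
      note e = split[OF this, unfolded jkl(1)]
      have "?S = {i, j, k, l}" unfolding e(1) by auto
      moreover have "distinct [i, j, k, l]" using e(2) jkl(2-) by auto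
      ultimately show ?thesis by blast
    qed
    have c2: "piece \<sigma> r I \<in> lmeasurable \<and> ?\<mu> I = 4 * (r^2 * arcsin (sqrt (2 / 3)) / sqrt 2 * \<sigma>)"
      if I: "I \<subseteq> ?S" "card I = 2" for I
    proof -
      have "card (?S - I) = 2" using I by (simp add: card_Diff_subset finite_subset)
      then obtain k l where kl: "?S - I = {k, l}" "k \<noteq> l" unfolding card_2_iff by blast
      obtain i j where ij: "I = {i, j}" "i \<noteq> j" using I(2) unfolding card_2_iff by blast
      note e = split[OF I(1), unfolded kl(1), unfolded ij(1)]
      have "?S = {i, j, k, l}" unfolding e(1) by auto
      moreover have "distinct [i, j, k, l]" using e(2) ij(2) kl(2) by auto
      ultimately show ?thesis using measure_piece2[OF assms, of i j k l] ij by blast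
    qed
    have c3: "piece \<sigma> r I \<in> lmeasurable \<and> ?\<mu> I = 2 * sqrt 3 * \<sigma>^2 * r"
      if I: "I \<subseteq> ?S" "card I = 3" for I
    proof -
      have "card (?S - I) = 1" using I by (simp add: card_Diff_subset finite_subset)
      then obtain l where l: "?S - I = {l}" by (rule card_1_singletonE)
      obtain i j k where ijk: "I = {i, j, k}" "i \<noteq> j" "j \<noteq> k" "i \<noteq> k"
        using I(2) unfolding card_3_iff by blast
      note e = split[OF I(1), unfolded l, unfolded ijk(1)]
      have "?S = {i, j, k, l}" unfolding e(1) by auto
      moreover have "distinct [i, j, k, l]" using e(2) ijk(2-) by auto
      ultimately show ?thesis using measure_piece3[OF assms, of i j k l] ijk by blast
    qed
    have v: "piece \<sigma> r {i} = (+) (\<sigma> *\<^sub>R w i) ` cone_sector r i" if i: "i < 4" for i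
      using c1[OF i] piece1[OF _ _ pos] by blast
    have meas: "piece \<sigma> r I \<in> lmeasurable" if "I \<subseteq> ?S" for I
    proof -
      have "card I \<le> 4" using card_mono[OF _ that] by simp
      then consider "card I = 0" | "card I = 1" | "card I = 2" | "card I = 3" | "card I = 4" by linarith
      then show ?thesis
      proof cases
        case 1
        then have "I = {}" using that by (simp add: finite_subset)
        then show ?thesis using piece_empty[OF pos] by simp
      next
        case 2
        then obtain i where "I = {i}" by (rule card_1_singletonE)
        then show ?thesis
          using that v[of i] measurable_translation[OF cone_sector_lmeasurable] by simp
      next
        case 5
        then have "I = ?S" using that by (intro card_subset_eq) auto
        then show ?thesis using measure_piece4 assms by simp
      qed (use c2 c3 that in auto)
    qed
    have "measure lebesgue (body \<sigma> r) = (\<Sum>I\<in>Pow ?S. ?\<mu> I)"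
      unfolding body_eq_pieces[OF pos]
      by (intro measure_negligible_finite_Union_image)
         (auto simp: meas pairwise_def piece_disjoint[OF pos])
    \<comment> \<open>Sorting the sixteen index sets by cardinality groups the faces by
      dimension.\<close>
    also have "\<dots> = (\<Sum>k\<in>{..4}. \<Sum>I | I \<in> Pow ?S \<and> card I = k. ?\<mu> I)"
      by (rule sum.group[symmetric]) (auto dest: card_mono[rotated])
    also have "\<dots> = (\<Sum>I | I \<subseteq> ?S \<and> card I = 0. ?\<mu> I) + (\<Sum>I | I \<subseteq> ?S \<and> card I = 1. ?\<mu> I)
        + (\<Sum>I | I \<subseteq> ?S \<and> card I = 2. ?\<mu> I) + (\<Sum>I | I \<subseteq> ?S \<and> card I = 3. ?\<mu> I)
        + (\<Sum>I | I \<subseteq> ?S \<and> card I = 4. ?\<mu> I)"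
      by (simp add: eval_nat_numeral atMost_Suc)
    also have "(\<Sum>I | I \<subseteq> ?S \<and> card I = 0. ?\<mu> I) = 0"
    proof (intro sum.neutral ballI)
      fix I assume "I \<in> {I. I \<subseteq> ?S \<and> card I = 0}"
      then have "I = {}" by (auto simp: finite_subset)
      then show "?\<mu> I = 0" using piece_empty[OF pos] by simp
    qed
    also have "(\<Sum>I | I \<subseteq> ?S \<and> card I = 1. ?\<mu> I) = 4 / 3 * pi * r^3"
    proof -
      have "{I. I \<subseteq> ?S \<and> card I = 1} = (\<lambda>i. {i}) ` ?S"
        by (auto simp: card_1_singleton_iff)
      then have "(\<Sum>I | I \<subseteq> ?S \<and> card I = 1. ?\<mu> I) = (\<Sum>i<4. ?\<mu> {i})"
        by (simp add: sum.reindex)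
      also have "\<dots> = (\<Sum>i<4. measure lebesgue (cone_sector r i))"
        by (intro sum.cong) (auto simp: v measure_translation)
      finally show ?thesis by (simp add: sum_measure_cone_sector ball)
    qed
    also have "(\<Sum>I | I \<subseteq> ?S \<and> card I = 2. ?\<mu> I) = 6 * (4 * (r^2 * arcsin (sqrt (2 / 3)) / sqrt 2 * \<sigma>))"
    proof -
      have "card {I. I \<subseteq> ?S \<and> card I = 2} = 6" by (simp add: n_subsets choose_two)
      then show ?thesis by (simp add: c2)
    qed
    also have "(\<Sum>I | I \<subseteq> ?S \<and> card I = 3. ?\<mu> I) = 4 * (2 * sqrt 3 * \<sigma>^2 * r)"
    proof -
      have "card {I. I \<subseteq> ?S \<and> card I = 3} = 4" by (simp add: n_subsets eval_nat_numeral)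
      then show ?thesis by (simp add: c3)
    qed
    also have "(\<Sum>I | I \<subseteq> ?S \<and> card I = 4. ?\<mu> I) = 8 / 3 * \<sigma>^3"
    proof -
      have "{I. I \<subseteq> ?S \<and> card I = 4} = {?S}"
        using card_subset_eq[of ?S] by (intro set_eqI iffI) simp_all
      then show ?thesis using measure_piece4[OF assms] by simp
    qed
    also have "0 + 4 / 3 * pi * r^3 + 6 * (4 * (r^2 * arcsin (sqrt (2 / 3)) / sqrt 2 * \<sigma>))
      + 4 * (2 * sqrt 3 * \<sigma>^2 * r) + 8 / 3 * \<sigma>^3
      = 8 / 3 * \<sigma>^3 + 8 * sqrt 3 * \<sigma>^2 * r
        + 12 * sqrt 2 * arcsin (sqrt (2 / 3)) * \<sigma> * r^2 + 4 / 3 * pi * r^3"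
      by (simp add: real_div_sqrt field_simps)
    finally show ?thesis .
  qed
qed

end

section \<open>Numerical enclosures of the constants\<close>

text \<open>\<open>alpha\<close> is \<open>pi / 2\<close> minus \<open>arcsin (1 / 3)\<close>, and
  the latter is enclosed by evaluating the Taylor polynomial of sine at two decimals. So many digits
  are kept because large terms cancel in the coefficients of the cubic.\<close>

lemma alpha_bounds: "1.23095941732 \<le> alpha" "alpha \<le> 1.23095941736"
proof -
  define P where "P x = x - x^3/6 + x^5/120 - x^7/5040 + x^9/362880" for x :: real
  have "(\<Sum>m<11. sin_coeff m * x ^ m) = P x" for x :: real
    by (simp add: P_def sin_coeff_def lessThan_nat_numeral lessThan_Suc fact_numeral)
  then have s: "\<bar>sin x - P x\<bar> \<le> inverse (fact 11) * \<bar>x\<bar> ^ 11" for x :: real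
    using Maclaurin_sin_bound[of x 11] by simp
  have "sin 0.339836909440 \<le> P 0.339836909440 + inverse (fact 11) * \<bar>0.339836909440\<bar> ^ 11"
    using s[of "0.339836909440"] by (simp only: abs_le_iff) linarith
  also have "\<dots> \<le> 1/3"
    unfolding P_def by (simp add: fact_numeral power_divide)
  finally have 1: "sin 0.339836909440 \<le> (1/3::real)" .
  have "(1/3::real) \<le> P 0.339836909470 - inverse (fact 11) * \<bar>0.339836909470\<bar> ^ 11"
    unfolding P_def by (simp add: fact_numeral power_divide)
  also have "\<dots> \<le> sin 0.339836909470"
    using s[of "0.339836909470"] by (simp only: abs_le_iff) linarith
  finally have 2: "(1/3::real) \<le> sin 0.339836909470" .
  have a: "alpha = pi/2 - arcsin (1/3)"
    unfolding alpha_def using arcsin_arccos_eq[of "1/3"] by simp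
  have "0.339836909440 \<le> arcsin (1/3)"
    using pi_approx 1 by (subst le_arcsin_iff) simp_all
  moreover have "arcsin (1/3) \<le> 0.339836909470"
    using pi_approx 2 by (subst arcsin_le_iff) simp_all
  ultimately show "1.23095941732 \<le> alpha" "alpha \<le> 1.23095941736"
    using pi_approx a by auto
qed

lemma sqrt_bounds:
  "1.4142135623730 \<le> sqrt 2" "sqrt 2 \<le> 1.4142135623731"
  "1.7320508075688 \<le> sqrt 3" "sqrt 3 \<le> 1.7320508075689"
  "2.4494897427831 \<le> sqrt 6" "sqrt 6 \<le> 2.4494897427832"
  by ((rule real_le_rsqrt real_le_lsqrt, simp_all add: power2_eq_square)[1])+

section \<open>The volume cubic and its maximum\<close>

text \<open>Here \<open>s\<close> scales the tetrahedron and \<open>1 - s\<close> the ball, so that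
  \<open>lambda_opt\<close> is a value of \<open>s\<close>.\<close>

definition interp_volume :: "real \<Rightarrow> real" where
  "interp_volume s = (let r = (sqrt 6 - sqrt 2) / 4 in
     sqrt 2 / 12 * s^3 + sqrt 3 * s^2 * ((1 - s) * r) + 3 * (pi - alpha) * s * ((1 - s) * r)^2
     + 4 / 3 * pi * ((1 - s) * r)^3)"

lemma mult_bounds:
  fixes x y :: real
  assumes "a \<le> x" "x \<le> b" "c \<le> y" "y \<le> d" "0 \<le> a" "0 \<le> c"
  shows "a * c \<le> x * y" "x * y \<le> b * d"
  using assms by (auto intro!: mult_mono)

text \<open>With these products enclosed as atoms, bounding the cubic's coefficients is linear
  arithmetic.\<close>

lemma product_bounds:
  "4.442882938154 \<le> sqrt 2 * pi" "sqrt 2 * pi \<le> 4.442882938162"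
  "5.441398092699 \<le> sqrt 3 * pi" "sqrt 3 * pi \<le> 5.441398092706"
  "7.695298980966 \<le> sqrt 6 * pi" "sqrt 6 * pi \<le> 7.695298980976"
  "2.13208425285 \<le> sqrt 3 * alpha" "sqrt 3 * alpha \<le> 2.13208425293"
  using mult_bounds[OF sqrt_bounds(1,2) pi_approx] mult_bounds[OF sqrt_bounds(3,4) pi_approx]
    mult_bounds[OF sqrt_bounds(5,6) pi_approx] mult_bounds[OF sqrt_bounds(3,4) alpha_bounds]
  by simp_all

text \<open>The first of the four coefficients of \<open>interp_volume\<close>. In
  \<open>lambda_opt\<close> the first fraction is \<open>4 * cubic_a2\<close> over
  \<open>- 12 * cubic_a3\<close>.\<close>

definition cubic_a3 :: real where
  "cubic_a3 = - (8 * sqrt 2 - 3 * sqrt 6 + c2 * pi + (18 - 9 * sqrt 3) * alpha) / 12"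

definition cubic_a2 :: real where
  "cubic_a2 = (3 * sqrt 2 - sqrt 6 + c1 * pi + (12 - 6 * sqrt 3) * alpha) / 4"

definition cubic_a1 :: real where
  "cubic_a1 = 3 * (pi - alpha) * (2 - sqrt 3) / 4 - pi * (3 * sqrt 6 - 5 * sqrt 2) / 4"

definition cubic_a0 :: real where
  "cubic_a0 = pi * (3 * sqrt 6 - 5 * sqrt 2) / 12"

text \<open>Multiplication table that reduces every product to a rational combination of 1,
  \<open>sqrt 2\<close>, \<open>sqrt 3\<close> and \<open>sqrt 6\<close>.\<close>

lemma sqrt_mult: "sqrt 2 * sqrt 3 = sqrt 6" "sqrt 2 * sqrt 6 = 2 * sqrt 3" "sqrt 3 * sqrt 6 = 3 * sqrt 2"
  "sqrt 2 * sqrt 2 = 2" "sqrt 3 * sqrt 3 = 3" "sqrt 6 * sqrt 6 = 6"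
  "sqrt 3 * sqrt 2 = sqrt 6" "sqrt 6 * sqrt 2 = 2 * sqrt 3" "sqrt 6 * sqrt 3 = 3 * sqrt 2"
  using real_sqrt_mult[of 2 3] real_sqrt_mult[of 4 3] real_sqrt_mult[of 9 2] by (simp_all add: real_sqrt_mult[symmetric])

lemma sqrt_mult_left: "sqrt 2 * (sqrt 3 * x) = sqrt 6 * x" "sqrt 2 * (sqrt 6 * x) = 2 * sqrt 3 * x" "sqrt 3 * (sqrt 6 * x) = 3 * sqrt 2 * x"
  "sqrt 2 * (sqrt 2 * x) = 2 * x" "sqrt 3 * (sqrt 3 * x) = 3 * x" "sqrt 6 * (sqrt 6 * x) = 6 * x"
  "sqrt 3 * (sqrt 2 * x) = sqrt 6 * x" "sqrt 6 * (sqrt 2 * x) = 2 * sqrt 3 * x" "sqrt 6 * (sqrt 3 * x) = 3 * sqrt 2 * x"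
  by (simp_all add: sqrt_mult mult.assoc[symmetric])

lemma interp_volume_expand: "interp_volume s = cubic_a3 * s^3 + cubic_a2 * s^2 + cubic_a1 * s + cubic_a0"
  unfolding interp_volume_def cubic_a3_def cubic_a2_def cubic_a1_def cubic_a0_def c1_def c2_def Let_def
  by (simp add: power2_eq_square power3_eq_cube field_simps sqrt_mult sqrt_mult_left)

text \<open>Identifies the long numerator in \<open>lambda_opt\<close> as 16 times a quarter of the
  discriminant of the cubic's derivative.\<close>

lemma discriminant_eq: "c3 + c4 * pi + c5 * pi\<^sup>2 + c6 * alpha + c7 * pi * alpha + c8 * alpha\<^sup>2 = 16 * (cubic_a2^2 - 3 * cubic_a3 * cubic_a1)"
  unfolding cubic_a3_def cubic_a2_def cubic_a1_def c1_def c2_def c3_def c4_def c5_def c6_def c7_def c8_def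
  by (simp add: power2_eq_square power3_eq_cube field_simps sqrt_mult sqrt_mult_left)

lemma cubic_bounds:
  "-0.0190956525 \<le> cubic_a3" "cubic_a3 \<le> -0.0190956522"
  "-0.1017706501 \<le> cubic_a2" "cubic_a2 \<le> -0.1017706497"
  "0.1660939112 \<le> cubic_a1" "cubic_a1 \<le> 0.1660939117"
proof -
  have "cubic_a3 = - (8 * sqrt 2 - 3 * sqrt 6 + 9 * (sqrt 3 * pi) + 3 * (sqrt 6 * pi) - 5 * (sqrt 2 * pi)
      - 18 * pi + 18 * alpha - 9 * (sqrt 3 * alpha)) / 12"
    by (simp add: cubic_a3_def c2_def algebra_simps)
  then show "-0.0190956525 \<le> cubic_a3" "cubic_a3 \<le> -0.0190956522"
    using product_bounds sqrt_bounds alpha_bounds pi_approx by simp_all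
  have "cubic_a2 = (3 * sqrt 2 - sqrt 6 + 6 * (sqrt 3 * pi) + 3 * (sqrt 6 * pi) - 5 * (sqrt 2 * pi)
      - 12 * pi + 12 * alpha - 6 * (sqrt 3 * alpha)) / 4"
    by (simp add: cubic_a2_def c1_def algebra_simps)
  then show "-0.1017706501 \<le> cubic_a2" "cubic_a2 \<le> -0.1017706497"
    using product_bounds sqrt_bounds alpha_bounds pi_approx by simp_all
  have "cubic_a1 = (6 * pi - 6 * alpha - 3 * (sqrt 3 * pi) + 3 * (sqrt 3 * alpha)
      - 3 * (sqrt 6 * pi) + 5 * (sqrt 2 * pi)) / 4"
    by (simp add: cubic_a1_def field_simps)
  then show "0.1660939112 \<le> cubic_a1" "cubic_a1 \<le> 0.1660939117"
    using product_bounds alpha_bounds pi_approx by simp_all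
qed

lemma cubic_a0_bounds: "0.07262352100 \<le> cubic_a0" "cubic_a0 \<le> 0.07262352103"
proof -
  have "cubic_a0 = (3 * (sqrt 6 * pi) - 5 * (sqrt 2 * pi)) / 12"
    by (simp add: cubic_a0_def algebra_simps)
  then show "0.07262352100 \<le> cubic_a0" "cubic_a0 \<le> 0.07262352103"
    using product_bounds by simp_all
qed

text \<open>The quadratic formula for the derivative. As \<open>cubic_a3\<close> is negative, the
  square root of the squared denominator is \<open>- 12 * cubic_a3\<close>, and the plus sign in
  \<open>lambda_opt\<close> selects the larger root.\<close>

lemma lambda_opt_eq: "lambda_opt = (- cubic_a2 - sqrt (cubic_a2^2 - 3 * cubic_a3 * cubic_a1)) / (3 * cubic_a3)"
proof -
  have d: "8 * sqrt 2 - 3 * sqrt 6 + c2 * pi + (18 - 9 * sqrt 3) * alpha = - (12 * cubic_a3)"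
      "8 * sqrt 2 - 3 * sqrt 6 + c9 * pi + (18 - 9 * sqrt 3) * alpha = - (12 * cubic_a3)"
    and n: "3 * sqrt 2 - sqrt 6 + c1 * pi + (12 - 6 * sqrt 3) * alpha = 4 * cubic_a2"
    by (simp_all add: cubic_a3_def cubic_a2_def c2_def c9_def field_simps)
  have "cubic_a3 < 0" using cubic_bounds by simp
  have root: "sqrt (16 * q / (- (12 * cubic_a3))\<^sup>2) = 4 * sqrt q / (- (12 * cubic_a3))" for q
    using \<open>cubic_a3 < 0\<close> by (simp add: real_sqrt_divide real_sqrt_mult)
  show ?thesis
    unfolding lambda_opt_def d n discriminant_eq root using \<open>cubic_a3 < 0\<close> by (simp add: field_simps)
qed

lemma lambda_opt_root: "3 * cubic_a3 * lambda_opt^2 + 2 * cubic_a2 * lambda_opt + cubic_a1 = 0"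
  and lambda_opt_nonneg: "0 \<le> lambda_opt"
proof -
  have neg: "cubic_a3 < 0" "cubic_a2 < 0" "0 < cubic_a1" using cubic_bounds by auto
  then have "cubic_a3 * cubic_a1 \<le> 0" by (intro mult_nonpos_nonneg) auto
  moreover have "3 * cubic_a3 * cubic_a1 = 3 * (cubic_a3 * cubic_a1)" by simp
  \<comment> \<open>Since \<open>cubic_a3\<close> and \<open>cubic_a1\<close> have opposite signs,
    the root of the discriminant outweighs \<open>cubic_a2\<close>, which makes the selected zero
    nonnegative.\<close>
  ultimately have D: "cubic_a2^2 \<le> cubic_a2^2 - 3 * cubic_a3 * cubic_a1" by linarith
  define q where "q = sqrt (cubic_a2^2 - 3 * cubic_a3 * cubic_a1)"
  have q2: "q^2 = cubic_a2^2 - 3 * cubic_a3 * cubic_a1"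
    unfolding q_def using D zero_le_power2[of cubic_a2] by (intro real_sqrt_pow2) linarith
  have "- cubic_a2 \<le> q"
    unfolding q_def using D neg by (intro real_le_rsqrt) simp
  then show "0 \<le> lambda_opt"
    unfolding lambda_opt_eq q_def[symmetric] using neg by (simp add: divide_nonpos_neg)
  define x where "x = lambda_opt"
  have "3 * cubic_a3 * x = - cubic_a2 - q"
    using neg by (simp add: x_def lambda_opt_eq q_def)
  then have "(3 * cubic_a3 * x + cubic_a2)^2 = q^2" by (simp add: power2_eq_square)
  then have "3 * cubic_a3 * (3 * cubic_a3 * x^2 + 2 * cubic_a2 * x + cubic_a1) = 0"
    unfolding q2 by (simp add: power2_eq_square algebra_simps)
  then show "3 * cubic_a3 * lambda_opt^2 + 2 * cubic_a2 * lambda_opt + cubic_a1 = 0"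
    using neg by (simp add: x_def)
qed

text \<open>The derivative decreases on the nonnegative reals, so its signs at two decimals enclose
  its zero.\<close>

lemma lambda_opt_bounds: "0.68424692 \<le> lambda_opt" "lambda_opt \<le> 0.68424694"
proof -
  have mono: "3 * cubic_a3 * y^2 + 2 * cubic_a2 * y + cubic_a1 \<le> 3 * cubic_a3 * x^2 + 2 * cubic_a2 * x + cubic_a1"
    if "0 \<le> x" "x \<le> y" for x y
  proof -
    have "cubic_a3 * y^2 \<le> cubic_a3 * x^2" "cubic_a2 * y \<le> cubic_a2 * x"
      using that cubic_bounds by (auto intro!: mult_left_mono_neg power_mono)
    then show ?thesis by simp
  qed
  have "0 < 3 * cubic_a3 * 0.68424692^2 + 2 * cubic_a2 * 0.68424692 + cubic_a1"
    using cubic_bounds by (simp add: power2_eq_square)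
  then show "0.68424692 \<le> lambda_opt"
    using mono[of lambda_opt "0.68424692"] lambda_opt_root lambda_opt_nonneg by force
  have "3 * cubic_a3 * 0.68424694^2 + 2 * cubic_a2 * 0.68424694 + cubic_a1 < 0"
    using cubic_bounds by (simp add: power2_eq_square)
  then show "lambda_opt \<le> 0.68424694"
    using mono[of "0.68424694" lambda_opt] lambda_opt_root lambda_opt_nonneg by force
qed

text \<open>At a critical point the difference has a double zero, which leaves a linear
  cofactor.\<close>

lemma interp_volume_gap:
  "interp_volume s - interp_volume lambda_opt
    = (s - lambda_opt)^2 * (cubic_a3 * s + 2 * cubic_a3 * lambda_opt + cubic_a2)"
proof -
  have C: "cubic_a1 = - 3 * cubic_a3 * lambda_opt^2 - 2 * cubic_a2 * lambda_opt"
    using lambda_opt_root by simp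
  show ?thesis unfolding interp_volume_expand C by (simp add: power2_eq_square power3_eq_cube algebra_simps)
qed

text \<open>The upper bound yields maximality; the crude lower bound limits the loss when
  \<open>lambda_opt\<close> is replaced by a nearby decimal.\<close>

lemma interp_volume_gap_bounds:
  assumes "0 \<le> s" "s \<le> 1"
  shows "cubic_a3 * s + 2 * cubic_a3 * lambda_opt + cubic_a2 \<le> 0" "-1 \<le> cubic_a3 * s + 2 * cubic_a3 * lambda_opt + cubic_a2"
proof -
  have "cubic_a3 * s \<le> 0" "cubic_a3 * lambda_opt \<le> 0" "cubic_a3 * 1 \<le> cubic_a3 * s" "cubic_a3 * 1 \<le> cubic_a3 * lambda_opt"
    using assms cubic_bounds lambda_opt_bounds
    by (intro mult_nonpos_nonneg mult_left_mono_neg; simp)+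
  moreover have "- (1 / 5) \<le> cubic_a3" "- (1 / 5) \<le> cubic_a2" "cubic_a2 \<le> 0"
    using cubic_bounds by simp_all
  ultimately show "cubic_a3 * s + 2 * cubic_a3 * lambda_opt + cubic_a2 \<le> 0"
    "-1 \<le> cubic_a3 * s + 2 * cubic_a3 * lambda_opt + cubic_a2"
    by linarith+
qed

lemma interp_volume_max:
  assumes "0 \<le> s" "s \<le> 1"
  shows "interp_volume s \<le> interp_volume lambda_opt"
  using interp_volume_gap[of s] mult_nonneg_nonpos[OF zero_le_power2 interp_volume_gap_bounds(1)[OF assms], of "s - lambda_opt"]
  by simp

lemma interp_volume_value:
  "\<bar>interp_volume lambda_opt / (sqrt 2 / 12) - 1.124358246\<bar> < 1 / 10 ^ 8"
proof -
  \<comment> \<open>The midpoint of the enclosure of \<open>lambda_opt\<close>. The error in the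
    volume is quadratic in the distance, hence at most \<open>1 / 10^16\<close>.\<close>
  define x where "x = (0.68424693::real)"
  define y where "y = interp_volume lambda_opt / (sqrt 2 / 12)"
  have "(x - lambda_opt)^2 * - 1 \<le> (x - lambda_opt)^2 * (cubic_a3 * x + 2 * cubic_a3 * lambda_opt + cubic_a2)"
    using interp_volume_gap_bounds[of x] by (intro mult_left_mono) (auto simp: x_def)
  then have "interp_volume lambda_opt \<le> interp_volume x + (x - lambda_opt)^2"
    using interp_volume_gap[of x] by simp
  moreover have "\<bar>x - lambda_opt\<bar> \<le> 1/10^8"
    using lambda_opt_bounds unfolding x_def by linarith
  then have "(x - lambda_opt)^2 \<le> (1/10^8)^2"
    by (metis abs_ge_zero power2_abs power_mono)
  moreover have "interp_volume x \<le> interp_volume lambda_opt"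
    by (rule interp_volume_max) (auto simp: x_def)
  moreover have "1.1243582363 * (sqrt 2 / 12) \<le> interp_volume x"
    "interp_volume x \<le> 1.12435825 * (sqrt 2 / 12)"
    unfolding interp_volume_expand x_def using cubic_bounds cubic_a0_bounds sqrt_bounds by (simp_all add: power_divide)
  ultimately have "1.12435823601 * (sqrt 2 / 12) \<le> interp_volume lambda_opt"
    "interp_volume lambda_opt \<le> 1.124358251 * (sqrt 2 / 12)"
    using sqrt_bounds by (auto simp: power_divide)
  then have "1.12435823601 \<le> interp_volume lambda_opt / (sqrt 2 / 12)"
    "interp_volume lambda_opt / (sqrt 2 / 12) \<le> 1.124358251"
    by (simp_all add: pos_le_divide_eq pos_divide_le_eq)
  then show ?thesis
    unfolding y_def[symmetric] abs_less_iff by simp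
qed

section \<open>From tetrahedra and balls to the parallel body\<close>

lemma convex_hull_image_lessThan:
  fixes v :: "nat \<Rightarrow> 'a::real_vector"
  assumes "inj_on v {..<n}"
  shows "convex hull (v ` {..<n})
    = {\<Sum>i<n. m i *\<^sub>R v i | m. (\<forall>i<n. 0 \<le> m i) \<and> (\<Sum>i<n. m i) = 1}" (is "_ = ?R")
proof -
  have "(\<exists>u. (\<forall>x\<in>v ` {..<n}. 0 \<le> u x) \<and> sum u (v ` {..<n}) = 1 \<and> (\<Sum>x\<in>v ` {..<n}. u x *\<^sub>R x) = y)
    \<longleftrightarrow> y \<in> ?R" (is "?L \<longleftrightarrow> _") for y
  proof
    assume ?L
    then obtain u where "\<forall>i<n. 0 \<le> u (v i)" "(\<Sum>i<n. u (v i)) = 1" "(\<Sum>i<n. u (v i) *\<^sub>R v i) = y"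
      by (auto simp: sum.reindex[OF assms])
    then show "y \<in> ?R" by (intro CollectI exI[of _ "\<lambda>i. u (v i)"]) auto
  next
    assume "y \<in> ?R"
    then obtain m where m: "\<forall>i<n. 0 \<le> m i" "(\<Sum>i<n. m i) = 1" "y = (\<Sum>i<n. m i *\<^sub>R v i)"
      by blast
    define u where "u x = m (inv_into {..<n} v x)" for x
    have "u (v i) = m i" if "i < n" for i
      using that assms by (simp add: u_def)
    then show ?L
      using m by (intro exI[of _ u]) (auto simp: sum.reindex[OF assms])
  qed
  then show ?thesis by (subst convex_hull_finite) auto
qed

text \<open>Moving the centroid to 0 and scaling by \<open>2 * sqrt 2\<close> turns squared
  centroid-vertex distance 3/8 into 3, as the frame demands.\<close>

lemma regular_tetrahedron_frame:
  assumes "regular_tetrahedron 1 T"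
  obtains c w where "tetra_frame w"
    "T = {c + (1 / (2 * sqrt 2)) *\<^sub>R tetra_frame.comb w m | m. (\<forall>i<4. 0 \<le> m i) \<and> (\<Sum>i<4. m i) = 1}"
proof -
  obtain p q r s where d: "dist p q = 1" "dist p r = 1" "dist p s = 1"
      "dist q r = 1" "dist q s = 1" "dist r s = 1"
    and T: "T = convex hull {p, q, r, s}"
    using assms unfolding regular_tetrahedron_def by auto
  define v where "v i = (if i = 0 then p else if i = 1 then q else if i = 2 then r else s)" for i :: nat
  define c where "c = (1/4) *\<^sub>R (p + q + r + s)"
  define w where "w i = (2 * sqrt 2) *\<^sub>R (v i - c)" for i
  define a b e where "a = q - p" and "b = r - p" and "e = s - p"
  have lt4: "i < 4 \<longleftrightarrow> i = 0 \<or> i = 1 \<or> i = 2 \<or> i = 3" for i :: nat by auto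
  have norms: "a \<bullet> a = 1" "b \<bullet> b = 1" "e \<bullet> e = 1"
      "(a - b) \<bullet> (a - b) = 1" "(a - e) \<bullet> (a - e) = 1" "(b - e) \<bullet> (b - e) = 1"
    using d by (simp_all add: a_def b_def e_def dist_norm norm_minus_commute power2_norm_eq_inner[symmetric])
  \<comment> \<open>Polarisation: edge vectors from a common vertex have inner product 1/2.\<close>
  then have in1: "a \<bullet> b = 1/2" "a \<bullet> e = 1/2" "b \<bullet> e = 1/2"
    by (simp_all add: inner_diff_left inner_diff_right inner_commute)
  then have in2: "b \<bullet> a = 1/2" "e \<bullet> a = 1/2" "e \<bullet> b = 1/2"
    by (simp_all add: inner_commute)
  have w: "w 0 = (sqrt 2 / 2) *\<^sub>R (- a - b - e)" "w 1 = (sqrt 2 / 2) *\<^sub>R (3 *\<^sub>R a - b - e)"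
      "w 2 = (sqrt 2 / 2) *\<^sub>R (3 *\<^sub>R b - a - e)" "w 3 = (sqrt 2 / 2) *\<^sub>R (3 *\<^sub>R e - a - b)"
    by (simp_all add: w_def v_def c_def a_def b_def e_def vec_eq_iff) (simp_all add: field_simps)
  have frame: "tetra_frame w"
  proof
    fix i j :: nat assume "i < 4" "j < 4"
    then show "w i \<bullet> w j = (if i = j then 3 else - 1)"
      unfolding lt4
      by (elim disjE; simp only: w; simp add: inner_diff_left inner_diff_right norms(1-3) in1 in2)
  qed
  interpret tetra_frame w by (rule frame)
  have "inj_on v {..<4}"
    using d unfolding inj_on_def by (auto simp: lt4 v_def)
  moreover have "v ` {..<4} = {p, q, r, s}"
  proof -
    have "{..<4} = {0, 1, 2, 3::nat}" by auto
    then show ?thesis by (simp add: v_def insert_commute)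
  qed
  ultimately have T': "T = {\<Sum>i<4. m i *\<^sub>R v i | m. (\<forall>i<4. 0 \<le> m i) \<and> (\<Sum>i<4. m i) = 1}"
    using T convex_hull_image_lessThan[of v 4] by simp
  have "(\<Sum>i<4. m i *\<^sub>R v i) = c + (1 / (2 * sqrt 2)) *\<^sub>R comb m" if "(\<Sum>i<4. m i) = 1" for m
  proof -
    have "(1 / (2 * sqrt 2)) *\<^sub>R comb m = (\<Sum>i<4. m i *\<^sub>R (v i - c))"
      unfolding comb_def scaleR_sum_right by (intro sum.cong) (simp_all add: w_def)
    also have "\<dots> = (\<Sum>i<4. m i *\<^sub>R v i) - (\<Sum>i<4. m i) *\<^sub>R c"
      by (simp add: scaleR_diff_right sum_subtractf scaleR_sum_left)
    finally show ?thesis using that by simp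
  qed
  then have "T = {c + (1 / (2 * sqrt 2)) *\<^sub>R comb m | m. (\<forall>i<4. 0 \<le> m i) \<and> (\<Sum>i<4. m i) = 1}"
    unfolding T' by (auto; metis)
  then show thesis using that frame by blast
qed

context tetra_frame
begin

text \<open>Both scalings are absorbed into the parameters of \<open>body\<close>, and the centres
  into a translation. The converse inclusion divides by \<open>1 - t\<close> and by
  \<open>t\<close>, so the two endpoints need separate witnesses.\<close>

lemma minkowski_interp_eq_body:
  assumes T: "T = {c + k *\<^sub>R comb m | m. (\<forall>i<4. 0 \<le> m i) \<and> (\<Sum>i<4. m i) = 1}"
    and "0 < k" "0 \<le> \<rho>" "0 \<le> t" "t \<le> 1"
  shows "minkowski_interp (1 - t) T t (cball z \<rho>)
    = (+) ((1 - t) *\<^sub>R c + t *\<^sub>R z) ` body ((1 - t) * k) (t * \<rho>)"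
proof (intro set_eqI iffI)
  fix x assume "x \<in> minkowski_interp (1 - t) T t (cball z \<rho>)"
  then obtain m y where m: "\<forall>i<4. 0 \<le> m i" "(\<Sum>i<4. m i) = 1" and y: "norm (y - z) \<le> \<rho>"
    and x: "x = (1 - t) *\<^sub>R (c + k *\<^sub>R comb m) + t *\<^sub>R y"
    unfolding minkowski_interp_def T by (auto simp: dist_norm norm_minus_commute)
  have "comb (\<lambda>i. (1 - t) * k * m i) + t *\<^sub>R (y - z) \<in> body ((1 - t) * k) (t * \<rho>)"
    unfolding body_def using m y assms
    by (intro CollectI exI[of _ "\<lambda>i. (1 - t) * k * m i"] exI[of _ "t *\<^sub>R (y - z)"])
       (auto simp: sum_distrib_left[symmetric] intro!: mult_left_mono)
  moreover have "x = (1 - t) *\<^sub>R c + t *\<^sub>R z + (comb (\<lambda>i. (1 - t) * k * m i) + t *\<^sub>R (y - z))"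
    unfolding x comb_scale by (simp add: algebra_simps)
  ultimately show "x \<in> (+) ((1 - t) *\<^sub>R c + t *\<^sub>R z) ` body ((1 - t) * k) (t * \<rho>)" by blast
next
  fix x assume "x \<in> (+) ((1 - t) *\<^sub>R c + t *\<^sub>R z) ` body ((1 - t) * k) (t * \<rho>)"
  then obtain l h where l: "\<forall>i<4. 0 \<le> l i" "(\<Sum>i<4. l i) = (1 - t) * k" and h: "norm h \<le> t * \<rho>"
    and x: "x = (1 - t) *\<^sub>R c + t *\<^sub>R z + (comb l + h)"
    unfolding body_def by auto
  have "\<exists>m. (\<forall>i<4. 0 \<le> m i) \<and> (\<Sum>i<4. m i) = 1 \<and> comb l = (1 - t) *\<^sub>R k *\<^sub>R comb m"
  proof (cases "t = 1")
    case True
    then have "\<forall>i<4. l i = 0" using l sum_nonneg_eq_0_iff[of "{..<4}" l] by auto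
    then have "comb l = 0" by (simp add: comb_def)
    \<comment> \<open>The tetrahedron has shrunk to a point, so any admissible weights
      serve.\<close>
    then show ?thesis using True by (intro exI[of _ "\<lambda>_. 1 / 4"]) simp
  next
    case False
    then have pos: "0 < (1 - t) * k" using assms by simp
    define m where "m i = inverse ((1 - t) * k) * l i" for i
    have nz: "(1 - t) * k \<noteq> 0" using pos by (metis less_irrefl)
    have "comb m = inverse ((1 - t) * k) *\<^sub>R comb l"
      unfolding m_def comb_scale ..
    then have "(1 - t) *\<^sub>R k *\<^sub>R comb m = ((1 - t) * k * inverse ((1 - t) * k)) *\<^sub>R comb l"
      by (simp only: scaleR_scaleR mult.assoc)
    then have "comb l = (1 - t) *\<^sub>R k *\<^sub>R comb m"
      unfolding right_inverse[OF nz] by simp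
    moreover have "(\<Sum>i<4. m i) = 1"
      unfolding m_def sum_distrib_left[symmetric] l(2) by (rule left_inverse[OF nz])
    moreover have "\<forall>i<4. 0 \<le> m i" using l(1) pos assms by (simp add: m_def)
    ultimately show ?thesis by blast
  qed
  then obtain m where m: "\<forall>i<4. 0 \<le> m i" "(\<Sum>i<4. m i) = 1" "comb l = (1 - t) *\<^sub>R k *\<^sub>R comb m"
    by blast
  have "\<exists>y. norm (y - z) \<le> \<rho> \<and> h = t *\<^sub>R (y - z)"
  proof (cases "t = 0")
    case True
    then show ?thesis using h assms by (intro exI[of _ z]) auto
  next
    case False
    then show ?thesis using h assms
      by (intro exI[of _ "z + inverse t *\<^sub>R h"]) (auto simp: field_simps)
  qed
  then obtain y where y: "norm (y - z) \<le> \<rho>" "h = t *\<^sub>R (y - z)" by blast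
  have "x = (1 - t) *\<^sub>R (c + k *\<^sub>R comb m) + t *\<^sub>R y"
    unfolding x m(3) y(2) by (simp add: algebra_simps)
  moreover have "c + k *\<^sub>R comb m \<in> T" unfolding T using m by blast
  moreover have "y \<in> cball z \<rho>" using y(1) by (simp add: dist_norm norm_minus_commute)
  ultimately show "x \<in> minkowski_interp (1 - t) T t (cball z \<rho>)"
    unfolding minkowski_interp_def by blast
qed

end

text \<open>Half the opening angle of a wedge. Doubling it gives cosine \<open>- 1 / 3\<close>, the
  cosine of the supplement of the dihedral angle \<open>alpha\<close>.\<close>

lemma arcsin_sqrt_two_thirds: "arcsin (sqrt (2 / 3)) = (pi - alpha) / 2"
proof -
  define b where "b = arcsin (sqrt (2 / 3))"
  have "- 1 \<le> sqrt (2 / 3)" by (rule order.trans[of _ 0]) auto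
  then have b: "0 \<le> b" "b \<le> pi / 2" "sin b = sqrt (2 / 3)"
    unfolding b_def by (intro arcsin_nonneg arcsin_ubound sin_arcsin; simp)+
  have "cos (2 * b) = - (1 / 3)"
    unfolding cos_double_sin by (simp add: b(3))
  then have "2 * b = arccos (- (1 / 3))"
    using arccos_cos[of "2 * b"] b by simp
  then show ?thesis
    unfolding b_def[symmetric] alpha_def by (simp add: arccos_minus)
qed

text \<open>Steiner's formula for edge length 1: volume \<open>sqrt 2 / 12\<close>, surface area
  \<open>sqrt 3\<close>, six edges contributing \<open>(pi - alpha) / 2\<close> each, and one full
  ball.\<close>

lemma Vol_minkowski_interp:
  assumes "regular_tetrahedron 1 T" "0 \<le> \<rho>" "0 \<le> t" "t \<le> 1"
  shows "Vol (minkowski_interp (1 - t) T t (cball z \<rho>)) =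
    sqrt 2 / 12 * (1 - t)^3 + sqrt 3 * (1 - t)^2 * (t * \<rho>)
    + 3 * (pi - alpha) * (1 - t) * (t * \<rho>)^2 + 4 / 3 * pi * (t * \<rho>)^3"
proof -
  obtain c w where "tetra_frame w"
    and T: "T = {c + (1 / (2 * sqrt 2)) *\<^sub>R tetra_frame.comb w m | m. (\<forall>i<4. 0 \<le> m i) \<and> (\<Sum>i<4. m i) = 1}"
    using regular_tetrahedron_frame[OF assms(1)] .
  interpret tetra_frame w by fact
  define u where "u = 1 - t"
  define \<sigma> where "\<sigma> = u * (1 / (2 * sqrt 2))"
  have "0 \<le> \<sigma>" using assms by (simp add: \<sigma>_def u_def)
  have "Vol (minkowski_interp (1 - t) T t (cball z \<rho>)) = measure lebesgue (body \<sigma> (t * \<rho>))"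
    unfolding Vol_def minkowski_interp_eq_body[OF T, simplified, OF assms(2-4)]
    by (simp add: measure_translation \<sigma>_def u_def)
  also have "\<dots> = 8 / 3 * \<sigma>^3 + 8 * sqrt 3 * \<sigma>^2 * (t * \<rho>)
    + 12 * sqrt 2 * arcsin (sqrt (2 / 3)) * \<sigma> * (t * \<rho>)^2 + 4 / 3 * pi * (t * \<rho>)^3"
    using \<open>0 \<le> \<sigma>\<close> assms by (intro measure_body) simp_all
  also have "8 / 3 * \<sigma>^3 = sqrt 2 / 12 * u^3"
    by (simp add: \<sigma>_def power3_eq_cube field_simps sqrt_mult_left)
  also have "\<sigma>^2 = u^2 / 8"
    by (simp add: \<sigma>_def power_mult_distrib power_divide)
  also have "12 * sqrt 2 * arcsin (sqrt (2 / 3)) * \<sigma> = 3 * (pi - alpha) * u"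
    unfolding arcsin_sqrt_two_thirds by (simp add: \<sigma>_def)
  finally show ?thesis by (simp add: u_def)
qed

lemma volume_ratio_eq:
  assumes "regular_tetrahedron 1 T" "B = cball z ((sqrt 6 - sqrt 2) / 4)" "0 \<le> t" "t \<le> 1"
  shows "volume_ratio T B t = interp_volume (1 - t) / (sqrt 2 / 12)"
proof -
  have r: "0 \<le> (sqrt 6 - sqrt 2) / 4" by simp
  \<comment> \<open>The volume of \<open>T\<close> itself is read off from the same formula at
    \<open>t = 0\<close>.\<close>
  have "minkowski_interp (1 - 0) T 0 B = T"
  proof -
    have "z \<in> B" using assms(2) r by simp
    then show ?thesis unfolding minkowski_interp_def by auto
  qed
  then have VT: "Vol T = sqrt 2 / 12"
    using Vol_minkowski_interp[OF assms(1) r, of 0 z] assms(2) by simp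
  have "1 - (1 - t) = t" by simp
  then show ?thesis
    unfolding volume_ratio_def VT assms(2) Vol_minkowski_interp[OF assms(1) r assms(3,4)]
      interp_volume_def Let_def by (simp only:)
qed

theorem theorem1:
  fixes T B :: "(real ^ 3) set" and z :: "real ^ 3"
  assumes "regular_tetrahedron 1 T"
    and "B = cball z ((sqrt 6 - sqrt 2) / 4)"
  shows "1 - lambda_opt \<in> {0..1} \<and>
         (\<forall>t\<in>{0..1}. volume_ratio T B t \<le> volume_ratio T B (1 - lambda_opt)) \<and>
         \<bar>lambda_opt - 0.68424688\<bar> < 1 / 10 ^ 7 \<and>
         \<bar>volume_ratio T B (1 - lambda_opt) - 1.124358246\<bar> < 1 / 10 ^ 8"
proof (intro conjI ballI)
  have l: "0 \<le> 1 - lambda_opt" "1 - lambda_opt \<le> 1" using lambda_opt_bounds by simp_all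
  then show "1 - lambda_opt \<in> {0..1}" by simp
  have ratio: "volume_ratio T B (1 - lambda_opt) = interp_volume lambda_opt / (sqrt 2 / 12)"
    using volume_ratio_eq[OF assms l] by simp
  show "volume_ratio T B t \<le> volume_ratio T B (1 - lambda_opt)" if "t \<in> {0..1}" for t
    using that interp_volume_max[of "1 - t"] unfolding ratio
    by (subst volume_ratio_eq[OF assms]) (auto intro!: divide_right_mono)
  \<comment> \<open>The enclosure places \<open>lambda_opt\<close> between 4 and 6 units of the
    eighth decimal above the quoted value, within the tolerance.\<close>
  show "\<bar>lambda_opt - 0.68424688\<bar> < 1 / 10 ^ 7"
    using lambda_opt_bounds unfolding abs_less_iff by simp
  show "\<bar>volume_ratio T B (1 - lambda_opt) - 1.124358246\<bar> < 1 / 10 ^ 8"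
    unfolding ratio by (rule interp_volume_value)
qed

end
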